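(* Let $N\geq2$ and let $P,Q$ be integers with $1\le P,Q<N$ and $P+Q=N$, and identify $G=\mathbb{Z}^N$ with $\mathbb{Z}^P\times\mathbb{Z}^Q$. Let $(D_i)_{i\in\mathbb{N}}$ be a sequence of $P\times Q$ matrices with coefficients in $(-\pi,\pi]$, and let $(U_i)=(U_{D_i})$ be the associated sequence of projective unitary representations of $G$ on $\ell^2(\mathbb{Z}^Q)$. Let $(n_i)_{i\in\mathbb{N}}$ be a sequence in $\mathbb{N}$. Set $H_i=\{b\in\mathbb{Z}^Q \mid 0\le b_k\le n_i,\ k=1,\ldots,Q\}$ and $\psi_i=\frac{1}{(\#H_i)^{1/2}}\chi_{H_i}$ for $i\in\mathbb{N}$, where $\chi_{H_i}$ is the characteristic function of $H_i$. Then $\otimes_iU_i$ exists on $\bigotimes_i^{\psi}\ell^2(\mathbb{Z}^Q)$, $\psi=(\psi_i)$, whenever $\sum_i1/n_i<\infty$ and $\sum_in_i|D_i|_\infty<\infty$.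
   Context: $\mathbb{N}=\{1,2,\ldots\}$. For a matrix $D=(d_{kl})$, $|D|_\infty=\max_{k,l}|d_{kl}|$. For a $P\times Q$ real matrix $D$ define the bilinear map $\sigma_D:\mathbb{Z}^P\times\mathbb{Z}^Q\to\mathbb{T}$ by $\sigma_D(a,b)=e^{ia\cdot(Db)}$. Define $U_D(a,b)=V_D(a)\lambda(b)$ for $(a,b)\in\mathbb{Z}^P\times\mathbb{Z}^Q$, where $V_D(a)$ is the operator on $\ell^2(\mathbb{Z}^Q)$ of multiplication by the function $b\mapsto\sigma_D(a,b)$ and $\lambda$ is the left regular representation of $\mathbb{Z}^Q$ on $\ell^2(\mathbb{Z}^Q)$. $U_D$ is a projective unitary representation of $G$, with 2-cocycle $((a_1,b_1),(a_2,b_2))\mapsto\overline{\sigma_D(a_2,b_1)}$. Infinite tensor products: for Hilbert spaces $\mathcal{H}_i$ and unit vectors $\psi_i\in\mathcal{H}_i$, $\psi=(\psi_i)$, the space $\mathcal{H}^\psi=\bigotimes_i^{\psi}\mathcal{H}_i$ is the completed inductive limit of the spaces $\mathcal{H}_1\otimes\cdots\otimes\mathcal{H}_n$ under the isometries $\eta\mapsto\eta\otimes\psi_{n+1}$. For bounded operators $T_i$ on $\mathcal{H}_i$ and a finite non-empty $J\subset\mathbb{N}$, let $\tilde T_J$ be the bounded operator on $\mathcal{H}^\psi$ acting as $T_i$ in the factors $i\in J$ and as the identity in the others. One says that $\otimes_iT_i$ exists on $\mathcal{H}^\psi$ if the net $(\tilde T_J)_J$ (indexed by finite non-empty subsets of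 $\mathbb{N}$ ordered by inclusion) converges in the strong operator topology to a bounded operator, which is then denoted $\otimes_iT_i$. "$\otimes_iU_i$ exists" means $\otimes_iU_i(x)$ exists for every $x\in G$. *)

theory Defs
  imports "HOL-Analysis.Analysis"
begin

section \<open>Complex inner product spaces on carrier sets\<close>

text \<open>
  The spaces below depend on the data \<open>\<psi>\<close>, so they are records over a carrier set rather than
  types.  Inner products are linear in the first argument.
\<close>

record 'v ip_space =
  vecs :: "'v set"
  vadd :: "'v \<Rightarrow> 'v \<Rightarrow> 'v"
  vscale :: "complex \<Rightarrow> 'v \<Rightarrow> 'v"
  vinner :: "'v \<Rightarrow> 'v \<Rightarrow> complex"

definition vnorm :: "'v ip_space \<Rightarrow> 'v \<Rightarrow> real" where
  "vnorm H x = sqrt (Re (vinner H x x))"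

definition vdist :: "'v ip_space \<Rightarrow> 'v \<Rightarrow> 'v \<Rightarrow> real" where
  "vdist H x y = vnorm H (vadd H x (vscale H (- 1) y))"

definition bounded_operator :: "'v ip_space \<Rightarrow> ('v \<Rightarrow> 'v) \<Rightarrow> bool" where
  "bounded_operator H T \<longleftrightarrow>
     (\<forall>x\<in>vecs H. T x \<in> vecs H) \<and>
     (\<forall>x\<in>vecs H. \<forall>y\<in>vecs H. T (vadd H x y) = vadd H (T x) (T y)) \<and>
     (\<forall>c. \<forall>x\<in>vecs H. T (vscale H c x) = vscale H c (T x)) \<and>
     (\<exists>C. \<forall>x\<in>vecs H. vnorm H (T x) \<le> C * vnorm H x)"

definition sot_tendsto ::
  "'v ip_space \<Rightarrow> ('j \<Rightarrow> 'v \<Rightarrow> 'v) \<Rightarrow> ('v \<Rightarrow> 'v) \<Rightarrow> 'j filter \<Rightarrow> bool" where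
  "sot_tendsto H T S F \<longleftrightarrow> (\<forall>x\<in>vecs H. ((\<lambda>j. vdist H (T j x) (S x)) \<longlongrightarrow> 0) F)"

text \<open>\<open>\<ell>\<^sup>2(A)\<close>, as functions on the whole type that vanish off \<open>A\<close>.\<close>

definition ell2 :: "'a set \<Rightarrow> ('a \<Rightarrow> complex) ip_space" where
  "ell2 A =
     \<lparr>vecs = {f. (\<forall>x. x \<notin> A \<longrightarrow> f x = 0) \<and> (\<lambda>x. (cmod (f x))\<^sup>2) summable_on A},
      vadd = (\<lambda>f g x. f x + g x),
      vscale = (\<lambda>c f x. c * f x),
      vinner = (\<lambda>f g. \<Sum>\<^sub>\<infinity>x\<in>A. f x * cnj (g x))\<rparr>"


section \<open>Completion\<close>

definition cauchy_seqs :: "'v ip_space \<Rightarrow> (nat \<Rightarrow> 'v) set" where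
  "cauchy_seqs H =
     {u. (\<forall>k. u k \<in> vecs H) \<and> (\<forall>e>0. \<exists>M. \<forall>m\<ge>M. \<forall>n\<ge>M. vdist H (u m) (u n) < e)}"

definition null_rel :: "'v ip_space \<Rightarrow> ((nat \<Rightarrow> 'v) \<times> (nat \<Rightarrow> 'v)) set" where
  "null_rel H =
     {(u, v). u \<in> cauchy_seqs H \<and> v \<in> cauchy_seqs H \<and> (\<lambda>k. vdist H (u k) (v k)) \<longlonglongrightarrow> 0}"

text \<open>
  Operations on equivalence classes are written as the class (image under the equivalence relation)
  of the results on all representatives; since the operations respect the relation, this image is a
  single class.
\<close>

definition completion :: "'v ip_space \<Rightarrow> (nat \<Rightarrow> 'v) set ip_space" where
  "completion H =
     \<lparr>vecs = cauchy_seqs H // null_rel H,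
      vadd = (\<lambda>A B. null_rel H `` {(\<lambda>k. vadd H (u k) (v k)) | u v. u \<in> A \<and> v \<in> B}),
      vscale = (\<lambda>c A. null_rel H `` {(\<lambda>k. vscale H c (u k)) | u. u \<in> A}),
      vinner = (\<lambda>A B. THE z. \<forall>u\<in>A. \<forall>v\<in>B. (\<lambda>k. vinner H (u k) (v k)) \<longlonglongrightarrow> z)\<rparr>"

definition completion_embed :: "'v ip_space \<Rightarrow> 'v \<Rightarrow> (nat \<Rightarrow> 'v) set" where
  "completion_embed H x = null_rel H `` {\<lambda>_. x}"


section \<open>Inductive limit of a sequence of spaces\<close>

text \<open>
  For isometries \<open>J n\<close> from \<open>V n\<close> to \<open>V (Suc n)\<close>, the composite from \<open>V n\<close> to \<open>V m\<close> is
  \<open>push J n m\<close>.  Elements of the inductive limit are classes of pairs \<open>(n, \<eta>)\<close> with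
  \<open>\<eta>\<close> in \<open>V n\<close>.
\<close>

definition push :: "(nat \<Rightarrow> 'v \<Rightarrow> 'v) \<Rightarrow> nat \<Rightarrow> nat \<Rightarrow> 'v \<Rightarrow> 'v" where
  "push J n m \<eta> = fold J [n..<m] \<eta>"

definition lim_rel ::
  "(nat \<Rightarrow> 'v ip_space) \<Rightarrow> (nat \<Rightarrow> 'v \<Rightarrow> 'v) \<Rightarrow> ((nat \<times> 'v) \<times> (nat \<times> 'v)) set" where
  "lim_rel V J =
     {((n, \<eta>), (m, \<zeta>)). \<eta> \<in> vecs (V n) \<and> \<zeta> \<in> vecs (V m) \<and>
        (\<exists>k. n \<le> k \<and> m \<le> k \<and> push J n k \<eta> = push J m k \<zeta>)}"

definition ind_lim ::
  "(nat \<Rightarrow> 'v ip_space) \<Rightarrow> (nat \<Rightarrow> 'v \<Rightarrow> 'v) \<Rightarrow> (nat \<times> 'v) set ip_space" where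
  "ind_lim V J =
     \<lparr>vecs = (SIGMA n:UNIV. vecs (V n)) // lim_rel V J,
      vadd = (\<lambda>A B. lim_rel V J ``
        {(max n m, vadd (V (max n m)) (push J n (max n m) \<eta>) (push J m (max n m) \<zeta>)) | n \<eta> m \<zeta>.
           (n, \<eta>) \<in> A \<and> (m, \<zeta>) \<in> B}),
      vscale = (\<lambda>c A. lim_rel V J `` {(n, vscale (V n) c \<eta>) | n \<eta>. (n, \<eta>) \<in> A}),
      vinner = (\<lambda>A B. THE z. \<forall>(n, \<eta>)\<in>A. \<forall>(m, \<zeta>)\<in>B.
        z = vinner (V (max n m)) (push J n (max n m) \<eta>) (push J m (max n m) \<zeta>))\<rparr>"

definition ind_lim_embed ::
  "(nat \<Rightarrow> 'v ip_space) \<Rightarrow> (nat \<Rightarrow> 'v \<Rightarrow> 'v) \<Rightarrow> nat \<Rightarrow> 'v \<Rightarrow> (nat \<times> 'v) set" where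
  "ind_lim_embed V J n \<eta> = lim_rel V J `` {(n, \<eta>)}"


section \<open>Infinite tensor products of copies of \<open>\<ell>\<^sup>2(X)\<close>\<close>

text \<open>
  The factors are numbered from 0, so index \<open>i\<close> here is index \<open>i + 1\<close> in the numbering by
  \<open>{1, 2, \<dots>}\<close>.  All factors are \<open>\<ell>\<^sup>2(X)\<close> with \<open>X\<close> a whole type.  The Hilbert space
  tensor product of the first \<open>n\<close> of them is \<open>\<ell>\<^sup>2(X\<^sup>n)\<close>, where \<open>X\<^sup>n\<close> is the set of lists of
  length \<open>n\<close> and \<open>v\<^sub>0 \<otimes> \<dots> \<otimes> v\<^sub>n\<^sub>-\<^sub>1\<close> is the function
  \<open>[b\<^sub>0, \<dots>, b\<^sub>n\<^sub>-\<^sub>1] \<mapsto> v\<^sub>0 b\<^sub>0 * \<dots> * v\<^sub>n\<^sub>-\<^sub>1 b\<^sub>n\<^sub>-\<^sub>1\<close>.  The space for \<open>n = 0\<close> is one-dimensional;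
  starting the inductive system there does not change the limit, since the \<open>\<psi> i\<close> are unit vectors.
\<close>

definition tensor_pow :: "nat \<Rightarrow> ('a list \<Rightarrow> complex) ip_space" where
  "tensor_pow n = ell2 {xs. length xs = n}"

definition tensor_snoc :: "('a list \<Rightarrow> complex) \<Rightarrow> ('a \<Rightarrow> complex) \<Rightarrow> 'a list \<Rightarrow> complex" where
  "tensor_snoc \<eta> v = (\<lambda>xs. if xs = [] then 0 else \<eta> (butlast xs) * v (last xs))"

primrec elem_tensor :: "(nat \<Rightarrow> 'a \<Rightarrow> complex) \<Rightarrow> nat \<Rightarrow> 'a list \<Rightarrow> complex" where
  "elem_tensor v 0 = (\<lambda>xs. if xs = [] then 1 else 0)"
| "elem_tensor v (Suc n) = tensor_snoc (elem_tensor v n) (v n)"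

definition finite_tensors ::
  "(nat \<Rightarrow> 'a \<Rightarrow> complex) \<Rightarrow> (nat \<times> ('a list \<Rightarrow> complex)) set ip_space" where
  "finite_tensors \<psi> = ind_lim tensor_pow (\<lambda>n \<eta>. tensor_snoc \<eta> (\<psi> n))"

definition inf_tensor ::
  "(nat \<Rightarrow> 'a \<Rightarrow> complex) \<Rightarrow> (nat \<Rightarrow> (nat \<times> ('a list \<Rightarrow> complex)) set) set ip_space" where
  "inf_tensor \<psi> = completion (finite_tensors \<psi>)"

definition inf_tensor_embed ::
  "(nat \<Rightarrow> 'a \<Rightarrow> complex) \<Rightarrow> nat \<Rightarrow> ('a list \<Rightarrow> complex) \<Rightarrow>
     (nat \<Rightarrow> (nat \<times> ('a list \<Rightarrow> complex)) set) set" where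
  "inf_tensor_embed \<psi> n \<eta> =
     completion_embed (finite_tensors \<psi>)
       (ind_lim_embed tensor_pow (\<lambda>n \<eta>. tensor_snoc \<eta> (\<psi> n)) n \<eta>)"

text \<open>
  \<open>S\<close> is the bounded operator acting as \<open>T i\<close> in the factors \<open>i \<in> J\<close> and as the identity in
  the others.  The elementary tensors \<open>v\<^sub>0 \<otimes> \<dots> \<otimes> v\<^sub>n\<^sub>-\<^sub>1 \<otimes> \<psi>\<^sub>n \<otimes> \<psi>\<^sub>n\<^sub>+\<^sub>1 \<otimes> \<dots>\<close> with \<open>n\<close> beyond
  all of \<open>J\<close> span a dense subspace, so \<open>S\<close> is unique on \<open>inf_tensor \<psi>\<close>.
\<close>

definition is_ampliation ::
  "(nat \<Rightarrow> 'a \<Rightarrow> complex) \<Rightarrow> (nat \<Rightarrow> ('a \<Rightarrow> complex) \<Rightarrow> 'a \<Rightarrow> complex) \<Rightarrow> nat set \<Rightarrow>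
     ((nat \<Rightarrow> (nat \<times> ('a list \<Rightarrow> complex)) set) set \<Rightarrow>
      (nat \<Rightarrow> (nat \<times> ('a list \<Rightarrow> complex)) set) set) \<Rightarrow> bool" where
  "is_ampliation \<psi> T J S \<longleftrightarrow>
     bounded_operator (inf_tensor \<psi>) S \<and>
     (\<forall>n v. J \<subseteq> {..<n} \<longrightarrow> (\<forall>i<n. v i \<in> vecs (ell2 UNIV)) \<longrightarrow>
        S (inf_tensor_embed \<psi> n (elem_tensor v n)) =
        inf_tensor_embed \<psi> n (elem_tensor (\<lambda>i. if i \<in> J then T i (v i) else v i) n))"

text \<open>
  \<open>\<Otimes>\<^sub>i T i\<close> exists on \<open>inf_tensor \<psi>\<close>.  The net is indexed by finite non-empty sets; the filter
  also ranges over the empty set, which is irrelevant for convergence.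
\<close>

definition tensor_op_exists ::
  "(nat \<Rightarrow> 'a \<Rightarrow> complex) \<Rightarrow> (nat \<Rightarrow> ('a \<Rightarrow> complex) \<Rightarrow> 'a \<Rightarrow> complex) \<Rightarrow> bool" where
  "tensor_op_exists \<psi> T \<longleftrightarrow>
     (\<exists>TJ S. (\<forall>J. finite J \<and> J \<noteq> {} \<longrightarrow> is_ampliation \<psi> T J (TJ J)) \<and>
             bounded_operator (inf_tensor \<psi>) S \<and>
             sot_tendsto (inf_tensor \<psi>) TJ S (finite_subsets_at_top UNIV))"


section \<open>The projective representations \<open>U\<^sub>D\<close>\<close>

text \<open>
  \<open>\<int>\<^sup>P\<close> is \<open>int ^ 'p\<close> with \<open>P = CARD('p)\<close>, and likewise for \<open>Q\<close>; thus
  \<open>G = \<int>\<^sup>P \<times> \<int>\<^sup>Q\<close> is \<open>(int ^ 'p) \<times> (int ^ 'q)\<close> with \<open>N = P + Q\<close>.  As \<open>P\<close> and \<open>Q\<close> are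
  automatically at least 1, the constraints \<open>N \<ge> 2\<close> and \<open>P, Q < N\<close> hold.
\<close>

definition real_vec :: "int ^ 'n \<Rightarrow> real ^ 'n" where
  "real_vec a = (\<chi> k. real_of_int (a $ k))"

definition sigma_D :: "real ^ 'q ^ 'p \<Rightarrow> int ^ 'p \<Rightarrow> int ^ 'q \<Rightarrow> complex" where
  "sigma_D D a b = exp (\<i> * complex_of_real (real_vec a \<bullet> (D *v real_vec b)))"

definition V_D :: "real ^ 'q ^ 'p \<Rightarrow> int ^ 'p \<Rightarrow> (int ^ 'q \<Rightarrow> complex) \<Rightarrow> int ^ 'q \<Rightarrow> complex" where
  "V_D D a f = (\<lambda>b. sigma_D D a b * f b)"

definition left_regular :: "int ^ 'q \<Rightarrow> (int ^ 'q \<Rightarrow> complex) \<Rightarrow> int ^ 'q \<Rightarrow> complex" where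
  "left_regular b f = (\<lambda>c. f (c - b))"

definition U_D ::
  "real ^ 'q ^ 'p \<Rightarrow> (int ^ 'p) \<times> (int ^ 'q) \<Rightarrow> (int ^ 'q \<Rightarrow> complex) \<Rightarrow> int ^ 'q \<Rightarrow> complex" where
  "U_D D x = V_D D (fst x) \<circ> left_regular (snd x)"

definition max_entry :: "real ^ 'q ^ 'p \<Rightarrow> real" where
  "max_entry D = Max {\<bar>D $ k $ l\<bar> | k l. True}"

definition int_box :: "nat \<Rightarrow> (int ^ 'q) set" where
  "int_box n = {b. \<forall>k. 0 \<le> b $ k \<and> b $ k \<le> int n}"

definition box_vec :: "nat \<Rightarrow> int ^ 'q \<Rightarrow> complex" where
  "box_vec n = (\<lambda>b. complex_of_real (1 / sqrt (real (card (int_box n :: (int ^ 'q) set)))) *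
                    indicator (int_box n) b)"

end

theory Submission
  imports Defs
begin

text \<open>
  Each \<open>U\<^sub>D(a, b)\<close> is a unitary that permutes the coordinates of \<open>\<ell>\<^sup>2\<close> and multiplies by phases, so
  its finite tensor products are explicit operators of the same kind on \<open>\<ell>\<^sup>2(X\<^sup>n)\<close>.  Let
  \<open>z\<^sub>i = \<langle>U\<^sub>i \<psi>\<^sub>i, \<psi>\<^sub>i\<rangle>\<close>.  If \<open>J\<close>, \<open>K\<close> both contain \<open>{..<M}\<close>, the ampliations to \<open>J\<close> and \<open>K\<close> of
  a vector \<open>\<eta> \<otimes> \<psi>\<^sub>n \<otimes> \<psi>\<^sub>n\<^sub>+\<^sub>1 \<otimes> \<dots>\<close> with \<open>n \<le> M\<close> have inner product \<open>\<parallel>\<eta>\<parallel>\<^sup>2\<close> times a finite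
  product of numbers \<open>z\<^sub>i\<close> or their conjugates with \<open>i \<ge> M\<close>; hence the net is Cauchy as soon as
  \<open>\<Sum>\<^sub>i \<bar>1 - z\<^sub>i\<bar> < \<infinity>\<close>.  For normalised box functions \<open>\<bar>1 - z\<^sub>i\<bar>\<close> is at most the proportion of the
  box that is lost under translation by \<open>b\<close>, which is \<open>O(1 / n\<^sub>i)\<close>, plus the oscillation of the phase
  on the box, which is \<open>O(n\<^sub>i \<bar>D\<^sub>i\<bar>\<^sub>\<infinity>)\<close>.
\<close>

subsection \<open>Semi-inner product spaces on carrier sets\<close>

text \<open>Operations on classes are defined as the image of the results on all representatives. If
  all these results are related to one \<open>x\<close>, the union of their classes collapses to the
  class of \<open>x\<close>; \<open>S\<close> must be non-empty because the image of the empty set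
  is empty.\<close>

lemma equiv_Image_eq_class:
  assumes "equiv A r" and "S \<noteq> {}" and "\<And>s. s \<in> S \<Longrightarrow> (x, s) \<in> r"
  shows "r `` S = r `` {x}"
proof -
  have "r `` {s} = r `` {x}" if "s \<in> S" for s
    using equiv_class_eq[OF assms(1) assms(3)[OF that]] by simp
  then show ?thesis
    using \<open>S \<noteq> {}\<close> by blast
qed

text \<open>Inner products are preserved, and not merely norms, because inner products in the
  inductive limit are computed after pushing representatives forward to a common level.\<close>

definition linear_isometry :: "'v ip_space \<Rightarrow> 'v ip_space \<Rightarrow> ('v \<Rightarrow> 'v) \<Rightarrow> bool" where
  "linear_isometry H K T \<longleftrightarrow>
     (\<forall>x\<in>vecs H. T x \<in> vecs K) \<and>
     (\<forall>x\<in>vecs H. \<forall>y\<in>vecs H. T (vadd H x y) = vadd K (T x) (T y)) \<and>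
     (\<forall>c. \<forall>x\<in>vecs H. T (vscale H c x) = vscale K c (T x)) \<and>
     (\<forall>x\<in>vecs H. \<forall>y\<in>vecs H. vinner K (T x) (T y) = vinner H x y)"

lemma linear_isometryD:
  assumes "linear_isometry H K T" and "x \<in> vecs H"
  shows "T x \<in> vecs K"
    and "y \<in> vecs H \<Longrightarrow> T (vadd H x y) = vadd K (T x) (T y)"
    and "T (vscale H c x) = vscale K c (T x)"
    and "y \<in> vecs H \<Longrightarrow> vinner K (T x) (T y) = vinner H x y"
    and "vnorm K (T x) = vnorm H x"
  using assms unfolding linear_isometry_def vnorm_def by auto

text \<open>No vector space axioms are required: identities between linear combinations are only ever
  needed up to distance 0, and those follow from sesquilinearity.\<close>

locale semi_inner =
  fixes H :: "'v ip_space"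
  assumes add_mem: "x \<in> vecs H \<Longrightarrow> y \<in> vecs H \<Longrightarrow> vadd H x y \<in> vecs H"
    and scale_mem: "x \<in> vecs H \<Longrightarrow> vscale H c x \<in> vecs H"
    and inner_add_left: "x \<in> vecs H \<Longrightarrow> y \<in> vecs H \<Longrightarrow> z \<in> vecs H \<Longrightarrow>
      vinner H (vadd H x y) z = vinner H x z + vinner H y z"
    and inner_scale_left: "x \<in> vecs H \<Longrightarrow> y \<in> vecs H \<Longrightarrow>
      vinner H (vscale H c x) y = c * vinner H x y"
    and inner_commute: "x \<in> vecs H \<Longrightarrow> y \<in> vecs H \<Longrightarrow> vinner H y x = cnj (vinner H x y)"
    and inner_self: "x \<in> vecs H \<Longrightarrow> 0 \<le> Re (vinner H x x)"
begin

section \<open>Sesquilinearity, norm and distance\<close>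

lemma inner_add_right:
  assumes "x \<in> vecs H" "y \<in> vecs H" "z \<in> vecs H"
  shows "vinner H z (vadd H x y) = vinner H z x + vinner H z y"
  using assms by (simp add: add_mem inner_commute[of _ z] inner_add_left)

lemma inner_scale_right:
  assumes "x \<in> vecs H" "y \<in> vecs H"
  shows "vinner H y (vscale H c x) = cnj c * vinner H y x"
  using assms by (simp add: scale_mem inner_commute[of _ y] inner_scale_left)

lemmas inner_simps = add_mem scale_mem inner_add_left inner_scale_left
  inner_add_right inner_scale_right

text \<open>Conjugate symmetry with both arguments equal forces the imaginary part to vanish, so the
  real part taken in \<open>vnorm\<close> loses nothing.\<close>

lemma inner_self_eq: "x \<in> vecs H \<Longrightarrow> vinner H x x = complex_of_real ((vnorm H x)\<^sup>2)"
  using arg_cong[OF inner_commute[of x x], of Im] inner_self[of x]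
  by (simp add: complex_eq_iff vnorm_def)

lemma Re_inner_commute: "x \<in> vecs H \<Longrightarrow> y \<in> vecs H \<Longrightarrow> Re (vinner H y x) = Re (vinner H x y)"
  using inner_commute[of x y] by simp

lemma vnorm_nonneg: "x \<in> vecs H \<Longrightarrow> 0 \<le> vnorm H x"
  by (simp add: vnorm_def inner_self)

lemma vdist_nonneg: "x \<in> vecs H \<Longrightarrow> y \<in> vecs H \<Longrightarrow> 0 \<le> vdist H x y"
  by (simp add: vdist_def vnorm_nonneg add_mem scale_mem)

text \<open>Turns a formula for an inner product into a distance estimate; this is how two
  ampliations of the same vector are compared.\<close>

lemma vdist_square:
  assumes "x \<in> vecs H" "y \<in> vecs H"
  shows "(vdist H x y)\<^sup>2 = (vnorm H x)\<^sup>2 - 2 * Re (vinner H x y) + (vnorm H y)\<^sup>2"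
proof -
  have "(vdist H x y)\<^sup>2 = Re (vinner H (vadd H x (vscale H (-1) y)) (vadd H x (vscale H (-1) y)))"
    using assms by (simp add: vdist_def vnorm_def inner_self add_mem scale_mem)
  also have "\<dots> = Re (vinner H x x) - 2 * Re (vinner H x y) + Re (vinner H y y)"
    using assms Re_inner_commute[of x y] by (simp add: inner_simps)
  finally show ?thesis
    using assms by (simp add: inner_self_eq)
qed

lemma vdist_commute: "x \<in> vecs H \<Longrightarrow> y \<in> vecs H \<Longrightarrow> vdist H x y = vdist H y x"
  by (rule power2_eq_imp_eq) (auto simp: vdist_square vdist_nonneg Re_inner_commute[of x y])

lemma vdist_self: "x \<in> vecs H \<Longrightarrow> vdist H x x = 0"
  using vdist_square[of x x] by (simp add: inner_self_eq)

text \<open>The squared norm of \<open>x - s b y\<close>, with \<open>b\<close> the inner product of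
  \<open>x\<close> and \<open>y\<close>, is a non-negative real quadratic in \<open>s\<close>. The
  form may be degenerate, so \<open>C = 0\<close> is a genuine separate case.\<close>

lemma Cauchy_Schwarz:
  assumes x: "x \<in> vecs H" and y: "y \<in> vecs H"
  shows "cmod (vinner H x y) \<le> vnorm H x * vnorm H y"
proof (rule ccontr)
  define b where "b = vinner H x y"
  define B where "B = (cmod b)\<^sup>2"
  define C where "C = (vnorm H y)\<^sup>2"
  define A where "A = (vnorm H x)\<^sup>2"
  assume "\<not> ?thesis"
  then have "vnorm H x * vnorm H y < cmod b"
    by (simp add: b_def)
  then have "(vnorm H x * vnorm H y)\<^sup>2 < (cmod b)\<^sup>2"
    using vnorm_nonneg[OF x] vnorm_nonneg[OF y] by (intro power_strict_mono) auto
  then have less: "A * C < B"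
    by (simp add: A_def B_def C_def power_mult_distrib)
  have A0: "0 \<le> A" and C0: "0 \<le> C"
    by (simp_all add: A_def C_def)
  then have B0: "0 < B"
    using less by (metis mult_nonneg_nonneg order_le_less_trans)
  have *: "0 \<le> A - 2 * s * B + s\<^sup>2 * B * C" for s :: real
  proof -
    \<comment> \<open>The factor \<open>b\<close> aligns the phases: both cross terms become
      \<open>- s * B\<close>, with \<open>s\<close> real.\<close>
    let ?z = "vadd H x (vscale H (- of_real s * b) y)"
    have bb: "b * cnj b = of_real B"
      by (simp add: B_def complex_norm_square del: of_real_power)
    have "vinner H ?z ?z = vinner H x x - of_real s * (b * cnj b) - of_real s * (b * cnj b)
        + of_real (s\<^sup>2) * (b * cnj b) * vinner H y y"
      using x y inner_commute[OF x y]
      by (simp add: inner_simps b_def[symmetric] power2_eq_square algebra_simps)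
    also have "\<dots> = of_real (A - 2 * s * B + s\<^sup>2 * B * C)"
      unfolding bb using x y by (simp add: inner_self_eq A_def C_def)
    finally show ?thesis
      using inner_self[of ?z] x y by (simp add: add_mem scale_mem)
  qed
  show False
  proof (cases "C = 0")
    case True
    \<comment> \<open>For \<open>C = 0\<close> the expression is linear in \<open>s\<close>, and
      this \<open>s\<close> gives it the value -1.\<close>
    with *[of "(A + 1) / (2 * B)"] A0 B0 show False by simp
  next
    case False
    \<comment> \<open>This \<open>s\<close> minimises the quadratic; the minimum is
      \<open>A - B / C\<close>.\<close>
    with *[of "1 / C"] have "B / C \<le> A"
      by (simp add: power2_eq_square)
    with less False C0 show False
      by (simp add: field_simps)
  qed
qed

lemma vnorm_add:
  assumes x: "x \<in> vecs H" and y: "y \<in> vecs H"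
  shows "vnorm H (vadd H x y) \<le> vnorm H x + vnorm H y"
proof (rule power2_le_imp_le)
  have "(vnorm H (vadd H x y))\<^sup>2 = (vnorm H x)\<^sup>2 + 2 * Re (vinner H x y) + (vnorm H y)\<^sup>2"
  proof -
    have "complex_of_real ((vnorm H (vadd H x y))\<^sup>2) = of_real ((vnorm H x)\<^sup>2) +
        (vinner H x y + vinner H y x) + of_real ((vnorm H y)\<^sup>2)"
      using x y by (simp add: inner_simps inner_self_eq[symmetric] del: of_real_power)
    also have "vinner H x y + vinner H y x = of_real (2 * Re (vinner H x y))"
      using inner_commute[OF x y] complex_add_cnj by simp
    finally show ?thesis
      by (simp only: of_real_add[symmetric] of_real_eq_iff)
  qed
  also have "\<dots> \<le> (vnorm H x + vnorm H y)\<^sup>2"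
    using Cauchy_Schwarz[OF x y] complex_Re_le_cmod[of "vinner H x y"]
    by (simp add: power2_sum)
  finally show "(vnorm H (vadd H x y))\<^sup>2 \<le> (vnorm H x + vnorm H y)\<^sup>2" .
qed (simp add: x y vnorm_nonneg)

lemma vdist_triangle:
  assumes "x \<in> vecs H" "y \<in> vecs H" "z \<in> vecs H"
  shows "vdist H x z \<le> vdist H x y + vdist H y z"
proof -
  \<comment> \<open>The two vectors under the norms need not be equal in the carrier; expanding both
    inner products shows that the norms agree.\<close>
  have "vdist H x z = vnorm H (vadd H (vadd H x (vscale H (-1) y)) (vadd H y (vscale H (-1) z)))"
    unfolding vdist_def vnorm_def using assms by (simp add: inner_simps)
  then show ?thesis
    unfolding vdist_def using assms vnorm_add by (simp add: add_mem scale_mem)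
qed

lemma vdist_vadd:
  assumes "x \<in> vecs H" "y \<in> vecs H" "x' \<in> vecs H" "y' \<in> vecs H"
  shows "vdist H (vadd H x y) (vadd H x' y') \<le> vdist H x x' + vdist H y y'"
proof -
  have "vdist H (vadd H x y) (vadd H x' y') =
      vnorm H (vadd H (vadd H x (vscale H (-1) x')) (vadd H y (vscale H (-1) y')))"
    unfolding vdist_def vnorm_def using assms by (simp add: inner_simps)
  then show ?thesis
    unfolding vdist_def using assms vnorm_add by (simp add: add_mem scale_mem)
qed

lemma vnorm_vscale: "x \<in> vecs H \<Longrightarrow> vnorm H (vscale H c x) = cmod c * vnorm H x"
proof -
  assume x: "x \<in> vecs H"
  have "complex_of_real ((vnorm H (vscale H c x))\<^sup>2) = of_real ((cmod c * vnorm H x)\<^sup>2)"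
    using x by (simp add: inner_simps inner_self_eq[symmetric] power_mult_distrib
        complex_norm_square mult_ac del: of_real_power)
  then show ?thesis
    unfolding of_real_eq_iff
    by (rule power2_eq_imp_eq) (simp_all add: x vnorm_nonneg scale_mem)
qed

lemma vdist_vscale:
  assumes "x \<in> vecs H" "y \<in> vecs H"
  shows "vdist H (vscale H c x) (vscale H c y) = cmod c * vdist H x y"
proof -
  have "vdist H (vscale H c x) (vscale H c y) = vnorm H (vscale H c (vadd H x (vscale H (-1) y)))"
    unfolding vdist_def vnorm_def using assms by (simp add: inner_simps algebra_simps)
  then show ?thesis
    unfolding vdist_def using assms by (simp add: vnorm_vscale add_mem scale_mem)
qed

lemma vnorm_diff_le:
  assumes "x \<in> vecs H" "y \<in> vecs H"
  shows "\<bar>vnorm H x - vnorm H y\<bar> \<le> vdist H x y"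
proof -
  have *: "vnorm H x \<le> vnorm H y + vdist H x y" if "x \<in> vecs H" "y \<in> vecs H" for x y
  proof -
    have "vnorm H x = vnorm H (vadd H y (vadd H x (vscale H (-1) y)))"
      unfolding vnorm_def using that by (simp add: inner_simps)
    then show ?thesis
      unfolding vdist_def using that vnorm_add by (simp add: add_mem scale_mem)
  qed
  show ?thesis
    using *[of x y] *[of y x] assms vdist_commute[of x y] by simp
qed

text \<open>Quantitative joint continuity of the inner product. It makes the limit of inner products
  along Cauchy sequences independent of the representatives.\<close>

lemma inner_diff_le:
  assumes "x \<in> vecs H" "y \<in> vecs H" "x' \<in> vecs H" "y' \<in> vecs H"
  shows "cmod (vinner H x y - vinner H x' y') \<le>
    vdist H x x' * vnorm H y + vnorm H x' * vdist H y y'"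
proof -
  have "vinner H x y - vinner H x' y' =
      vinner H (vadd H x (vscale H (-1) x')) y + vinner H x' (vadd H y (vscale H (-1) y'))"
    using assms by (simp add: inner_simps)
  also have "cmod \<dots> \<le> vdist H x x' * vnorm H y + vnorm H x' * vdist H y y'"
    unfolding vdist_def using assms
    by (intro norm_triangle_mono Cauchy_Schwarz) (auto simp: add_mem scale_mem)
  finally show ?thesis .
qed

lemma vdist_isometry:
  assumes "linear_isometry H H T" "x \<in> vecs H" "y \<in> vecs H"
  shows "vdist H (T x) (T y) = vdist H x y"
proof -
  have "vadd H (T x) (vscale H (-1) (T y)) = T (vadd H x (vscale H (-1) y))"
    using assms by (simp add: linear_isometryD scale_mem)
  then show ?thesis
    unfolding vdist_def using linear_isometryD(5)[OF assms(1), of "vadd H x (vscale H (-1) y)"]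
    by (simp add: assms(2,3) add_mem scale_mem)
qed


subsection \<open>Completion\<close>

lemma cauchy_seqsD:
  assumes "u \<in> cauchy_seqs H"
  shows "u k \<in> vecs H"
    and "0 < e \<Longrightarrow> \<exists>M. \<forall>m\<ge>M. \<forall>n\<ge>M. vdist H (u m) (u n) < e"
  using assms by (auto simp: cauchy_seqs_def)

lemma const_cauchy: "x \<in> vecs H \<Longrightarrow> (\<lambda>_. x) \<in> cauchy_seqs H"
  by (auto simp: cauchy_seqs_def vdist_self)

lemma vnorm_cauchy_convergent:
  assumes "u \<in> cauchy_seqs H"
  shows "convergent (\<lambda>k. vnorm H (u k))"
  unfolding Cauchy_convergent_iff[symmetric]
proof (rule metric_CauchyI)
  fix e :: real
  assume "0 < e"
  then obtain M where "\<forall>m\<ge>M. \<forall>n\<ge>M. vdist H (u m) (u n) < e"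
    using cauchy_seqsD(2)[OF assms] by blast
  then show "\<exists>M. \<forall>m\<ge>M. \<forall>n\<ge>M. dist (vnorm H (u m)) (vnorm H (u n)) < e"
    using vnorm_diff_le[OF cauchy_seqsD(1)[OF assms] cauchy_seqsD(1)[OF assms]]
    by (metis dist_real_def order_le_less_trans)
qed

lemma vadd_cauchy:
  assumes u: "u \<in> cauchy_seqs H" and v: "v \<in> cauchy_seqs H"
  shows "(\<lambda>k. vadd H (u k) (v k)) \<in> cauchy_seqs H"
proof -
  have "\<exists>M. \<forall>m\<ge>M. \<forall>n\<ge>M. vdist H (vadd H (u m) (v m)) (vadd H (u n) (v n)) < e" if "0 < e" for e
  proof -
    obtain M1 where M1: "\<forall>m\<ge>M1. \<forall>n\<ge>M1. vdist H (u m) (u n) < e / 2"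
      using cauchy_seqsD(2)[OF u, of "e / 2"] \<open>0 < e\<close> by auto
    obtain M2 where M2: "\<forall>m\<ge>M2. \<forall>n\<ge>M2. vdist H (v m) (v n) < e / 2"
      using cauchy_seqsD(2)[OF v, of "e / 2"] \<open>0 < e\<close> by auto
    have "vdist H (vadd H (u m) (v m)) (vadd H (u n) (v n)) < e"
      if "m \<ge> max M1 M2" "n \<ge> max M1 M2" for m n
    proof -
      have "vdist H (u m) (u n) < e / 2" "vdist H (v m) (v n) < e / 2"
        using M1 M2 that by auto
      then show ?thesis
        using vdist_vadd[of "u m" "v m" "u n" "v n"] cauchy_seqsD(1)[OF u] cauchy_seqsD(1)[OF v]
        by (smt (verit) field_sum_of_halves)
    qed
    then show ?thesis by blast
  qed
  then show ?thesis
    using cauchy_seqsD(1)[OF u] cauchy_seqsD(1)[OF v] by (simp add: cauchy_seqs_def add_mem)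
qed

lemma vscale_cauchy:
  assumes u: "u \<in> cauchy_seqs H"
  shows "(\<lambda>k. vscale H c (u k)) \<in> cauchy_seqs H"
proof -
  have "\<exists>M. \<forall>m\<ge>M. \<forall>n\<ge>M. vdist H (vscale H c (u m)) (vscale H c (u n)) < e" if "0 < e" for e
  proof -
    \<comment> \<open>Adding 1 keeps the quotient meaningful for \<open>c = 0\<close>.\<close>
    have "0 < e / (cmod c + 1)"
      using \<open>0 < e\<close> by (simp add: add_nonneg_pos)
    then obtain M where M: "\<forall>m\<ge>M. \<forall>n\<ge>M. vdist H (u m) (u n) < e / (cmod c + 1)"
      using cauchy_seqsD(2)[OF u] by blast
    have "vdist H (vscale H c (u m)) (vscale H c (u n)) < e" if "m \<ge> M" "n \<ge> M" for m n
    proof -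
      have "(cmod c + 1) * vdist H (u m) (u n) < e"
        using M that by (simp add: pos_less_divide_eq add_nonneg_pos mult.commute)
      moreover have "cmod c * vdist H (u m) (u n) \<le> (cmod c + 1) * vdist H (u m) (u n)"
        by (intro mult_right_mono vdist_nonneg cauchy_seqsD(1)[OF u]) simp
      ultimately show ?thesis
        by (simp add: vdist_vscale cauchy_seqsD(1)[OF u])
    qed
    then show ?thesis by blast
  qed
  then show ?thesis
    using cauchy_seqsD(1)[OF u] by (simp add: cauchy_seqs_def scale_mem)
qed

lemma null_relI:
  assumes "u \<in> cauchy_seqs H" "v \<in> cauchy_seqs H"
    and "\<And>k. vdist H (u k) (v k) \<le> f k" and "f \<longlonglongrightarrow> 0"
  shows "(u, v) \<in> null_rel H"
  unfolding null_rel_def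
  using assms cauchy_seqsD(1)
  by (auto intro!: tendsto_sandwich[OF always_eventually always_eventually tendsto_const assms(4)]
      vdist_nonneg)

lemma null_relD:
  assumes "(u, v) \<in> null_rel H"
  shows "u \<in> cauchy_seqs H" "v \<in> cauchy_seqs H" "(\<lambda>k. vdist H (u k) (v k)) \<longlonglongrightarrow> 0"
  using assms by (auto simp: null_rel_def)

lemma equiv_null_rel: "equiv (cauchy_seqs H) (null_rel H)"
proof (rule equivI)
  show "null_rel H \<subseteq> cauchy_seqs H \<times> cauchy_seqs H"
    by (auto simp: null_rel_def)
  show "refl_on (cauchy_seqs H) (null_rel H)"
    by (auto simp: refl_on_def null_rel_def vdist_self cauchy_seqsD(1))
  show "sym (null_rel H)"
    by (auto simp: sym_def null_rel_def intro: Lim_transform_eventually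
        always_eventually vdist_commute cauchy_seqsD(1))
  show "trans (null_rel H)"
  proof (rule transI)
    fix u v w
    assume uv: "(u, v) \<in> null_rel H" and vw: "(v, w) \<in> null_rel H"
    show "(u, w) \<in> null_rel H"
      using tendsto_add[OF null_relD(3)[OF uv] null_relD(3)[OF vw]]
      by (intro null_relI[where f = "\<lambda>k. vdist H (u k) (v k) + vdist H (v k) (w k)"])
        (auto intro!: vdist_triangle null_relD[OF uv] null_relD[OF vw] cauchy_seqsD(1))
  qed
qed

definition seq_class :: "(nat \<Rightarrow> 'v) \<Rightarrow> (nat \<Rightarrow> 'v) set" where
  "seq_class u = null_rel H `` {u}"

lemma mem_seq_class: "v \<in> seq_class u \<longleftrightarrow> (u, v) \<in> null_rel H"
  by (simp add: seq_class_def)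

lemma self_mem_seq_class: "u \<in> cauchy_seqs H \<Longrightarrow> u \<in> seq_class u"
  unfolding seq_class_def by (rule equiv_class_self[OF equiv_null_rel])

lemma seq_class_mem: "u \<in> cauchy_seqs H \<Longrightarrow> seq_class u \<in> vecs (completion H)"
  by (simp add: completion_def seq_class_def quotientI)

lemma vecs_completionE:
  assumes "A \<in> vecs (completion H)"
  obtains u where "u \<in> cauchy_seqs H" "A = seq_class u"
  using assms by (auto simp: completion_def seq_class_def elim: quotientE)

lemma seq_class_eqI:
  assumes "S \<noteq> {}" and "\<And>s. s \<in> S \<Longrightarrow> (u, s) \<in> null_rel H"
  shows "null_rel H `` S = seq_class u"
  unfolding seq_class_def using assms by (rule equiv_Image_eq_class[OF equiv_null_rel])

lemma vadd_seq_class: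
  assumes u: "u \<in> cauchy_seqs H" and v: "v \<in> cauchy_seqs H"
  shows "vadd (completion H) (seq_class u) (seq_class v) = seq_class (\<lambda>k. vadd H (u k) (v k))"
proof -
  have "null_rel H `` {(\<lambda>k. vadd H (u' k) (v' k)) | u' v'. u' \<in> seq_class u \<and> v' \<in> seq_class v} =
      seq_class (\<lambda>k. vadd H (u k) (v k))"
  proof (rule seq_class_eqI)
    show "{(\<lambda>k. vadd H (u' k) (v' k)) | u' v'. u' \<in> seq_class u \<and> v' \<in> seq_class v} \<noteq> {}"
      using self_mem_seq_class u v by blast
  next
    fix s
    assume "s \<in> {(\<lambda>k. vadd H (u' k) (v' k)) | u' v'. u' \<in> seq_class u \<and> v' \<in> seq_class v}"
    then obtain u' v' where s: "s = (\<lambda>k. vadd H (u' k) (v' k))"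
      and u': "(u, u') \<in> null_rel H" and v': "(v, v') \<in> null_rel H"
      by (auto simp: mem_seq_class)
    show "(\<lambda>k. vadd H (u k) (v k), s) \<in> null_rel H"
      unfolding s using tendsto_add[OF null_relD(3)[OF u'] null_relD(3)[OF v']]
      by (intro null_relI[where f = "\<lambda>k. vdist H (u k) (u' k) + vdist H (v k) (v' k)"])
        (auto intro!: vadd_cauchy vdist_vadd null_relD[OF u'] null_relD[OF v'] cauchy_seqsD(1))
  qed
  then show ?thesis by (simp add: completion_def)
qed

lemma vscale_seq_class:
  assumes u: "u \<in> cauchy_seqs H"
  shows "vscale (completion H) c (seq_class u) = seq_class (\<lambda>k. vscale H c (u k))"
proof -
  have "null_rel H `` {(\<lambda>k. vscale H c (u' k)) | u'. u' \<in> seq_class u} =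
      seq_class (\<lambda>k. vscale H c (u k))"
  proof (rule seq_class_eqI)
    show "{(\<lambda>k. vscale H c (u' k)) | u'. u' \<in> seq_class u} \<noteq> {}"
      using self_mem_seq_class u by blast
  next
    fix s
    assume "s \<in> {(\<lambda>k. vscale H c (u' k)) | u'. u' \<in> seq_class u}"
    then obtain u' where s: "s = (\<lambda>k. vscale H c (u' k))" and u': "(u, u') \<in> null_rel H"
      by (auto simp: mem_seq_class)
    show "(\<lambda>k. vscale H c (u k), s) \<in> null_rel H"
      unfolding s using tendsto_mult_right_zero[OF null_relD(3)[OF u'], of "cmod c"]
      by (intro null_relI[where f = "\<lambda>k. cmod c * vdist H (u k) (u' k)"])
        (auto intro!: vscale_cauchy null_relD[OF u'] cauchy_seqsD(1)
          simp: vdist_vscale[OF null_relD(1)[OF u', THEN cauchy_seqsD(1)]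
                                null_relD(2)[OF u', THEN cauchy_seqsD(1)]])
  qed
  then show ?thesis by (simp add: completion_def)
qed

text \<open>The inner product in the completion is a definite description over all pairs of
  representatives. All pairs from the class of \<open>u\<close> share the limit
  \<open>L\<^sup>2\<close>, which determines the description; since \<open>L\<close> is
  non-negative, it is the norm.\<close>

lemma vnorm_seq_class:
  assumes u: "u \<in> cauchy_seqs H"
  shows "(\<lambda>k. vnorm H (u k)) \<longlonglongrightarrow> vnorm (completion H) (seq_class u)"
proof -
  obtain L where L: "(\<lambda>k. vnorm H (u k)) \<longlonglongrightarrow> L"
    using vnorm_cauchy_convergent[OF u] by (auto simp: convergent_def)
  have *: "(\<lambda>k. vinner H (v k) (w k)) \<longlonglongrightarrow> complex_of_real (L\<^sup>2)"
    if v: "(u, v) \<in> null_rel H" and w: "(u, w) \<in> null_rel H" for v w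
  proof -
    note mem = null_relD(1,2)[OF v, THEN cauchy_seqsD(1)] null_relD(2)[OF w, THEN cauchy_seqsD(1)]
    obtain L' where L': "(\<lambda>k. vnorm H (w k)) \<longlonglongrightarrow> L'"
      using vnorm_cauchy_convergent[OF null_relD(2)[OF w]] by (auto simp: convergent_def)
    have "(\<lambda>k. vdist H (u k) (v k) * vnorm H (w k) + vnorm H (u k) * vdist H (u k) (w k))
        \<longlonglongrightarrow> 0 * L' + L * 0"
      by (intro tendsto_intros L L' null_relD(3)[OF v] null_relD(3)[OF w])
    then have lim0: "(\<lambda>k. vdist H (u k) (v k) * vnorm H (w k) + vnorm H (u k) * vdist H (u k) (w k))
        \<longlonglongrightarrow> 0"
      by simp
    have le: "norm (vinner H (v k) (w k) - vinner H (u k) (u k)) \<le>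
        vdist H (u k) (v k) * vnorm H (w k) + vnorm H (u k) * vdist H (u k) (w k)" for k
      using inner_diff_le[of "v k" "w k" "u k" "u k"] mem vdist_commute by simp
    have "(\<lambda>k. vinner H (v k) (w k) - vinner H (u k) (u k)) \<longlonglongrightarrow> 0"
      by (rule Lim_null_comparison[OF _ lim0]) (intro always_eventually allI le)
    moreover have "(\<lambda>k. vinner H (u k) (u k)) \<longlonglongrightarrow> complex_of_real (L\<^sup>2)"
      unfolding inner_self_eq[OF mem(1)] by (intro tendsto_intros L)
    ultimately show ?thesis
      using tendsto_add by fastforce
  qed
  have "vinner (completion H) (seq_class u) (seq_class u) = complex_of_real (L\<^sup>2)"
  proof -
    have "(THE z. \<forall>v\<in>seq_class u. \<forall>w\<in>seq_class u. (\<lambda>k. vinner H (v k) (w k)) \<longlonglongrightarrow> z) =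
        complex_of_real (L\<^sup>2)"
      using self_mem_seq_class[OF u]
      by (intro the_equality ballI) (metis * mem_seq_class, metis * mem_seq_class LIMSEQ_unique)
    then show ?thesis by (simp add: completion_def)
  qed
  moreover have "0 \<le> L"
    using L by (rule LIMSEQ_le_const) (auto intro: vnorm_nonneg cauchy_seqsD(1)[OF u])
  ultimately show ?thesis
    using L by (simp add: vnorm_def[of "completion H"] real_sqrt_unique)
qed

lemma vdist_seq_class:
  assumes u: "u \<in> cauchy_seqs H" and v: "v \<in> cauchy_seqs H"
  shows "(\<lambda>k. vdist H (u k) (v k)) \<longlonglongrightarrow> vdist (completion H) (seq_class u) (seq_class v)"
  unfolding vdist_def vscale_seq_class[OF v] vadd_seq_class[OF u vscale_cauchy[OF v]]
  by (rule vnorm_seq_class[OF vadd_cauchy[OF u vscale_cauchy[OF v]]])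


subsection \<open>Strong limits of isometries on the completion\<close>

text \<open>The strong limit of \<open>T k\<close>, realised on representatives by the diagonal sequence
  \<open>T k (u k)\<close>; a constant sequence \<open>T\<close> gives the continuous extension of a single isometry.\<close>

definition strong_limit :: "(nat \<Rightarrow> 'v \<Rightarrow> 'v) \<Rightarrow> (nat \<Rightarrow> 'v) set \<Rightarrow> (nat \<Rightarrow> 'v) set" where
  "strong_limit T A = null_rel H `` {(\<lambda>k. T k (u k)) | u. u \<in> A}"

text \<open>An argument with three thirds: \<open>T m (u m)\<close> and \<open>T n (u n)\<close> are
  compared through \<open>T m (u M1)\<close> and \<open>T n (u M1)\<close>. The outer distances are
  uniform in \<open>m\<close> and \<open>n\<close> because the \<open>T k\<close> are isometric, and
  the middle one involves the single fixed vector \<open>u M1\<close>.\<close>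

lemma diagonal_cauchy:
  assumes T: "\<And>k. linear_isometry H H (T k)"
    and T_cauchy: "\<And>x. x \<in> vecs H \<Longrightarrow> (\<lambda>k. T k x) \<in> cauchy_seqs H"
    and u: "u \<in> cauchy_seqs H"
  shows "(\<lambda>k. T k (u k)) \<in> cauchy_seqs H"
proof -
  note mem = cauchy_seqsD(1)[OF u]
  have "\<exists>M. \<forall>m\<ge>M. \<forall>n\<ge>M. vdist H (T m (u m)) (T n (u n)) < e" if "0 < e" for e
  proof -
    obtain M1 where M1: "\<And>m n. m \<ge> M1 \<Longrightarrow> n \<ge> M1 \<Longrightarrow> vdist H (u m) (u n) < e / 3"
      using cauchy_seqsD(2)[OF u, of "e / 3"] \<open>0 < e\<close> by auto
    obtain M2 where M2: "\<And>m n. m \<ge> M2 \<Longrightarrow> n \<ge> M2 \<Longrightarrow> vdist H (T m (u M1)) (T n (u M1)) < e / 3"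
      using cauchy_seqsD(2)[OF T_cauchy[OF mem], of "e / 3" M1] \<open>0 < e\<close> by auto
    have "vdist H (T m (u m)) (T n (u n)) < e" if "m \<ge> max M1 M2" "n \<ge> max M1 M2" for m n
    proof -
      have *: "T i (u j) \<in> vecs H" for i j
        by (rule linear_isometryD(1)[OF T mem])
      have "vdist H (T m (u m)) (T n (u n)) \<le> vdist H (T m (u m)) (T m (u M1)) +
          (vdist H (T m (u M1)) (T n (u M1)) + vdist H (T n (u M1)) (T n (u n)))"
        using vdist_triangle[OF *[of m m] *[of m M1] *[of n n]]
          vdist_triangle[OF *[of m M1] *[of n M1] *[of n n]] by linarith
      also have "\<dots> < e / 3 + (e / 3 + e / 3)"
        unfolding vdist_isometry[OF T mem mem] using that
        by (intro add_strict_mono M1 M2) auto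
      finally show ?thesis by simp
    qed
    then show ?thesis by blast
  qed
  then show ?thesis
    using linear_isometryD(1)[OF T mem] by (simp add: cauchy_seqs_def)
qed

context
  fixes T :: "nat \<Rightarrow> 'v \<Rightarrow> 'v"
  assumes T: "\<And>k. linear_isometry H H (T k)"
    and T_cauchy: "\<And>x. x \<in> vecs H \<Longrightarrow> (\<lambda>k. T k x) \<in> cauchy_seqs H"
begin

text \<open>Applying the isometry \<open>T k\<close> to the \<open>k\<close>-th terms leaves the
  distance between two representatives unchanged, so equivalent sequences have equivalent
  diagonals.\<close>

lemma strong_limit_seq_class:
  assumes u: "u \<in> cauchy_seqs H"
  shows "strong_limit T (seq_class u) = seq_class (\<lambda>k. T k (u k))"
  unfolding strong_limit_def
proof (rule seq_class_eqI)
  show "{(\<lambda>k. T k (u' k)) | u'. u' \<in> seq_class u} \<noteq> {}"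
    using self_mem_seq_class u by blast
next
  fix s
  assume "s \<in> {(\<lambda>k. T k (u' k)) | u'. u' \<in> seq_class u}"
  then obtain u' where s: "s = (\<lambda>k. T k (u' k))" and u': "(u, u') \<in> null_rel H"
    by (auto simp: mem_seq_class)
  show "(\<lambda>k. T k (u k), s) \<in> null_rel H"
    unfolding s
  proof (rule null_relI[OF _ _ _ null_relD(3)[OF u']])
    fix k
    show "vdist H (T k (u k)) (T k (u' k)) \<le> vdist H (u k) (u' k)"
      using vdist_isometry[OF T cauchy_seqsD(1)[OF null_relD(1)[OF u']]
          cauchy_seqsD(1)[OF null_relD(2)[OF u']]] by simp
  qed (rule diagonal_cauchy[OF T T_cauchy] null_relD[OF u'] | assumption)+
qed

lemma bounded_operator_strong_limit: "bounded_operator (completion H) (strong_limit T)"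
  unfolding bounded_operator_def
\<comment> \<open>The bound is 1 because the strong limit of isometries preserves norms.\<close>
proof (intro conjI ballI allI exI[of _ 1])
  fix A
  assume "A \<in> vecs (completion H)"
  then obtain u where u: "u \<in> cauchy_seqs H" "A = seq_class u"
    by (rule vecs_completionE)
  note Tu = diagonal_cauchy[OF T T_cauchy u(1)]
  show "strong_limit T A \<in> vecs (completion H)"
    by (simp add: u strong_limit_seq_class seq_class_mem Tu)
  have "vnorm (completion H) (strong_limit T A) = vnorm (completion H) A"
    using vnorm_seq_class[OF Tu] vnorm_seq_class[OF u(1)]
    by (simp add: u strong_limit_seq_class linear_isometryD(5)[OF T cauchy_seqsD(1)[OF u(1)]]
        LIMSEQ_unique)
  then show "vnorm (completion H) (strong_limit T A) \<le> 1 * vnorm (completion H) A"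
    by simp
  fix c
  show "strong_limit T (vscale (completion H) c A) = vscale (completion H) c (strong_limit T A)"
    using linear_isometryD(3)[OF T cauchy_seqsD(1)[OF u(1)]]
    by (simp add: u vscale_seq_class vscale_cauchy strong_limit_seq_class Tu)
next
  fix A B
  assume "A \<in> vecs (completion H)" "B \<in> vecs (completion H)"
  then obtain u v where u: "u \<in> cauchy_seqs H" "A = seq_class u"
    and v: "v \<in> cauchy_seqs H" "B = seq_class v"
    by (metis vecs_completionE)
  show "strong_limit T (vadd (completion H) A B) =
      vadd (completion H) (strong_limit T A) (strong_limit T B)"
    using linear_isometryD(2)[OF T cauchy_seqsD(1)[OF u(1)] cauchy_seqsD(1)[OF v(1)]]
    by (simp add: u v vadd_seq_class vadd_cauchy strong_limit_seq_class
        diagonal_cauchy[OF T T_cauchy])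
qed

lemma strong_limit_embed:
  assumes "x \<in> vecs H"
  shows "strong_limit T (completion_embed H x) = seq_class (\<lambda>k. T k x)"
  using strong_limit_seq_class[OF const_cauchy[OF assms]]
  by (simp add: completion_embed_def seq_class_def)

end

text \<open>All operators involved are isometric, so convergence on the dense image of
  \<open>H\<close> carries over to the completion. The limit of \<open>T k x\<close> need not lie in
  \<open>H\<close>, hence closeness of \<open>R j x\<close> to it is phrased as closeness to
  \<open>T k x\<close> for all large \<open>k\<close>.\<close>

lemma sot_tendsto_strong_limit:
  assumes T: "\<And>k. linear_isometry H H (T k)"
    and T_cauchy: "\<And>x. x \<in> vecs H \<Longrightarrow> (\<lambda>k. T k x) \<in> cauchy_seqs H"
    and R: "eventually (\<lambda>j. linear_isometry H H (R j)) F"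
    and RT: "\<And>x e. x \<in> vecs H \<Longrightarrow> 0 < e \<Longrightarrow>
      \<forall>\<^sub>F j in F. \<forall>\<^sub>F k in sequentially. vdist H (R j x) (T k x) < e"
  shows "sot_tendsto (completion H) (\<lambda>j. strong_limit (\<lambda>_. R j)) (strong_limit T) F"
  unfolding sot_tendsto_def
proof
  fix A
  assume "A \<in> vecs (completion H)"
  then obtain u where u: "u \<in> cauchy_seqs H" "A = seq_class u"
    by (rule vecs_completionE)
  note mem = cauchy_seqsD(1)[OF u(1)]
  show "((\<lambda>j. vdist (completion H) (strong_limit (\<lambda>_. R j) A) (strong_limit T A)) \<longlongrightarrow> 0) F"
  proof (rule tendstoI)
    fix e :: real
    assume e: "0 < e"
    \<comment> \<open>Three quarters of \<open>e\<close> are spent. The passage to the limit in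
      \<open>k\<close> preserves only the weak inequality, so the last quarter provides
      strictness.\<close>
    obtain M where M: "\<And>m n. m \<ge> M \<Longrightarrow> n \<ge> M \<Longrightarrow> vdist H (u m) (u n) < e / 4"
      using cauchy_seqsD(2)[OF u(1), of "e / 4"] e by auto
    have "\<forall>\<^sub>F j in F. \<forall>\<^sub>F k in sequentially. vdist H (R j (u M)) (T k (u M)) < e / 4"
      using RT[OF mem, of "e / 4"] e by simp
    with R show "\<forall>\<^sub>F j in F. dist (vdist (completion H) (strong_limit (\<lambda>_. R j) A) (strong_limit T A)) 0 < e"
    proof eventually_elim
      fix j
      assume Rj: "linear_isometry H H (R j)"
        and lim: "\<forall>\<^sub>F k in sequentially. vdist H (R j (u M)) (T k (u M)) < e / 4"
      have Rj_cauchy: "\<And>x. x \<in> vecs H \<Longrightarrow> (\<lambda>_. R j x) \<in> cauchy_seqs H"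
        using Rj by (auto intro: const_cauchy linear_isometryD)
      have *: "R j (u i) \<in> vecs H" "T k (u i) \<in> vecs H" for i k
        by (rule linear_isometryD(1)[OF Rj mem], rule linear_isometryD(1)[OF T mem])
      note conv = vdist_seq_class[OF diagonal_cauchy[of "\<lambda>_. R j", OF Rj Rj_cauchy u(1)]
          diagonal_cauchy[OF T T_cauchy u(1)]]
      have "\<forall>\<^sub>F k in sequentially. vdist H (R j (u k)) (T k (u k)) \<le> 3 * (e / 4)"
        using lim eventually_ge_at_top[of M]
      proof eventually_elim
        fix k
        assume k: "vdist H (R j (u M)) (T k (u M)) < e / 4" "M \<le> k"
        have "vdist H (R j (u k)) (T k (u k)) \<le> vdist H (R j (u k)) (R j (u M)) +
            (vdist H (R j (u M)) (T k (u M)) + vdist H (T k (u M)) (T k (u k)))"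
          using vdist_triangle[OF *(1)[of k] *(1)[of M] *(2)[of k k]]
            vdist_triangle[OF *(1)[of M] *(2)[of k M] *(2)[of k k]] by linarith
        also have "\<dots> \<le> e / 4 + (e / 4 + e / 4)"
          using M[of k M] M[of M k] k
          by (intro add_mono) (auto simp: vdist_isometry[OF T mem mem] vdist_isometry[OF Rj mem mem])
        finally show "vdist H (R j (u k)) (T k (u k)) \<le> 3 * (e / 4)" by simp
      qed
      with conv have "vdist (completion H) (seq_class (\<lambda>k. R j (u k))) (seq_class (\<lambda>k. T k (u k)))
          \<le> 3 * (e / 4)"
        by (intro tendsto_upperbound) auto
      moreover have "0 \<le> vdist (completion H) (seq_class (\<lambda>k. R j (u k))) (seq_class (\<lambda>k. T k (u k)))"
        using conv by (rule LIMSEQ_le_const) (auto intro: vdist_nonneg *)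
      ultimately show "dist (vdist (completion H) (strong_limit (\<lambda>_. R j) A) (strong_limit T A)) 0 < e"
        using e by (simp add: u strong_limit_seq_class[OF T T_cauchy]
            strong_limit_seq_class[of "\<lambda>_. R j", OF Rj Rj_cauchy])
    qed
  qed
qed

end


subsection \<open>Inductive limits\<close>

locale isometric_system =
  fixes V :: "nat \<Rightarrow> 'v ip_space" and J :: "nat \<Rightarrow> 'v \<Rightarrow> 'v"
  assumes semi_inner_level: "semi_inner (V n)"
    and isometry_step: "linear_isometry (V n) (V (Suc n)) (J n)"
begin

lemma push_refl [simp]: "push J n n \<eta> = \<eta>"
  by (simp add: push_def)

lemma push_Suc: "n \<le> m \<Longrightarrow> push J n (Suc m) \<eta> = J m (push J n m \<eta>)"
  by (simp add: push_def)

lemma push_push: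
  assumes "n \<le> m" "m \<le> k"
  shows "push J m k (push J n m \<eta>) = push J n k \<eta>"
  using assms(2) by (induction k rule: dec_induct) (use assms(1) in \<open>simp_all add: push_Suc\<close>)

lemma linear_isometry_push:
  assumes "n \<le> m"
  shows "linear_isometry (V n) (V m) (push J n m)"
  using assms
proof (induction m rule: dec_induct)
  case base
  show ?case by (simp add: linear_isometry_def)
next
  case (step m)
  have "linear_isometry (V n) (V (Suc m)) (\<lambda>\<eta>. J m (push J n m \<eta>))"
    using step.IH isometry_step[of m] unfolding linear_isometry_def by simp
  then show ?case
    using step.hyps by (simp add: linear_isometry_def push_Suc)
qed

lemmas pushD = linear_isometryD[OF linear_isometry_push]

text \<open>Once two representatives agree at some level they agree at every later one. A whole
  final segment of levels is supplied so that several relations can be used at a common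
  level.\<close>

lemma lim_relD:
  assumes "((n, \<eta>), (m, \<zeta>)) \<in> lim_rel V J"
  obtains k0 where "\<And>k. k0 \<le> k \<Longrightarrow> n \<le> k" "\<And>k. k0 \<le> k \<Longrightarrow> m \<le> k"
    "\<And>k. k0 \<le> k \<Longrightarrow> push J n k \<eta> = push J m k \<zeta>"
    "\<eta> \<in> vecs (V n)" "\<zeta> \<in> vecs (V m)"
proof -
  obtain k0 where k0: "n \<le> k0" "m \<le> k0" "push J n k0 \<eta> = push J m k0 \<zeta>"
    and mem: "\<eta> \<in> vecs (V n)" "\<zeta> \<in> vecs (V m)"
    using assms by (auto simp: lim_rel_def)
  have "push J n k \<eta> = push J m k \<zeta>" if "k0 \<le> k" for k
    using k0 that push_push[of n k0 k \<eta>] push_push[of m k0 k \<zeta>] by simp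
  then show thesis
    using k0 mem that[of k0] by (meson order_trans)
qed

lemma lim_relI:
  assumes "\<eta> \<in> vecs (V n)" "\<zeta> \<in> vecs (V m)" "n \<le> k" "m \<le> k" "push J n k \<eta> = push J m k \<zeta>"
  shows "((n, \<eta>), (m, \<zeta>)) \<in> lim_rel V J"
  using assms by (auto simp: lim_rel_def)

lemma equiv_lim_rel: "equiv (SIGMA n:UNIV. vecs (V n)) (lim_rel V J)"
proof (rule equivI)
  show "lim_rel V J \<subseteq> (SIGMA n:UNIV. vecs (V n)) \<times> (SIGMA n:UNIV. vecs (V n))"
    by (auto simp: lim_rel_def)
  show "refl_on (SIGMA n:UNIV. vecs (V n)) (lim_rel V J)"
    by (auto simp: refl_on_def lim_rel_def)
  show "sym (lim_rel V J)"
    by (rule symI) (auto simp: lim_rel_def dest: sym)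
  show "trans (lim_rel V J)"
  proof (rule transI)
    fix p q r
    assume pq: "(p, q) \<in> lim_rel V J" and qr: "(q, r) \<in> lim_rel V J"
    obtain n \<eta> m \<zeta> l \<theta> where pqr: "p = (n, \<eta>)" "q = (m, \<zeta>)" "r = (l, \<theta>)"
      by (metis prod.exhaust)
    obtain k1 where k1: "\<And>k. k1 \<le> k \<Longrightarrow> n \<le> k" "\<And>k. k1 \<le> k \<Longrightarrow> push J n k \<eta> = push J m k \<zeta>"
      "\<eta> \<in> vecs (V n)"
      using pq unfolding pqr by (rule lim_relD) (rule that; assumption)
    obtain k2 where k2: "\<And>k. k2 \<le> k \<Longrightarrow> l \<le> k" "\<And>k. k2 \<le> k \<Longrightarrow> push J m k \<zeta> = push J l k \<theta>"
      "\<theta> \<in> vecs (V l)"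
      using qr unfolding pqr by (rule lim_relD) (rule that; assumption)
    show "(p, r) \<in> lim_rel V J"
      unfolding pqr using k1 k2 by (intro lim_relI[where k = "max k1 k2"]) auto
  qed
qed

abbreviation germ :: "nat \<Rightarrow> 'v \<Rightarrow> (nat \<times> 'v) set" where
  "germ \<equiv> ind_lim_embed V J"

lemma mem_germ: "(m, \<zeta>) \<in> germ n \<eta> \<longleftrightarrow> ((n, \<eta>), (m, \<zeta>)) \<in> lim_rel V J"
  by (simp add: ind_lim_embed_def)

lemma self_mem_germ: "\<eta> \<in> vecs (V n) \<Longrightarrow> (n, \<eta>) \<in> germ n \<eta>"
  by (auto simp: mem_germ intro: lim_relI)

lemma germ_mem: "\<eta> \<in> vecs (V n) \<Longrightarrow> germ n \<eta> \<in> vecs (ind_lim V J)"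
  by (auto simp: ind_lim_def ind_lim_embed_def intro!: quotientI)

lemma germ_push: "\<eta> \<in> vecs (V n) \<Longrightarrow> n \<le> m \<Longrightarrow> germ m (push J n m \<eta>) = germ n \<eta>"
  unfolding ind_lim_embed_def
  by (rule equiv_class_eq[OF equiv_lim_rel]) (auto intro!: lim_relI[where k = m] pushD(1))

text \<open>A representative can be pushed to any later level, so finitely many elements always have
  representatives on one common level, where the operations are those of \<open>V n\<close>.\<close>

lemma vecs_ind_limE:
  assumes "A \<in> vecs (ind_lim V J)"
  obtains n0 where "\<And>n. n0 \<le> n \<Longrightarrow> \<exists>\<eta>\<in>vecs (V n). A = germ n \<eta>"
proof -
  obtain n0 \<eta> where "\<eta> \<in> vecs (V n0)" "A = germ n0 \<eta>"
    using assms by (auto simp: ind_lim_def ind_lim_embed_def elim!: quotientE)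
  then show thesis
    by (intro that[of n0]) (metis germ_push pushD(1))
qed

lemma germ_eqI:
  assumes "S \<noteq> {}" and "\<And>m \<zeta>. (m, \<zeta>) \<in> S \<Longrightarrow> ((n, \<eta>), (m, \<zeta>)) \<in> lim_rel V J"
  shows "lim_rel V J `` S = germ n \<eta>"
  unfolding ind_lim_embed_def using assms by (intro equiv_Image_eq_class[OF equiv_lim_rel]) auto

text \<open>The definition adds representatives taken from unrelated levels. At a late enough level
  \<open>k\<close> each of them coincides with the push of \<open>\<eta>\<close> or
  \<open>\<zeta>\<close>, and pushing is additive.\<close>

lemma vadd_germ:
  assumes \<eta>: "\<eta> \<in> vecs (V n)" and \<zeta>: "\<zeta> \<in> vecs (V n)"
  shows "vadd (ind_lim V J) (germ n \<eta>) (germ n \<zeta>) = germ n (vadd (V n) \<eta> \<zeta>)"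
proof -
  define S where "S = {(max i j, vadd (V (max i j)) (push J i (max i j) \<eta>') (push J j (max i j) \<zeta>')) |
    i \<eta>' j \<zeta>'. (i, \<eta>') \<in> germ n \<eta> \<and> (j, \<zeta>') \<in> germ n \<zeta>}"
  have "lim_rel V J `` S = germ n (vadd (V n) \<eta> \<zeta>)"
  proof (rule germ_eqI)
    show "S \<noteq> {}"
      using self_mem_germ \<eta> \<zeta> unfolding S_def by blast
  next
    fix m \<theta>
    assume "(m, \<theta>) \<in> S"
    then obtain i \<eta>' j \<zeta>' where m: "m = max i j"
      and \<theta>: "\<theta> = vadd (V m) (push J i m \<eta>') (push J j m \<zeta>')"
      and i: "((n, \<eta>), (i, \<eta>')) \<in> lim_rel V J" and j: "((n, \<zeta>), (j, \<zeta>')) \<in> lim_rel V J"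
      unfolding S_def by (auto simp: mem_germ)
    obtain k1 where k1: "\<And>k. k1 \<le> k \<Longrightarrow> n \<le> k" "\<And>k. k1 \<le> k \<Longrightarrow> i \<le> k"
      "\<And>k. k1 \<le> k \<Longrightarrow> push J n k \<eta> = push J i k \<eta>'" "\<eta>' \<in> vecs (V i)"
      using i by (rule lim_relD) (rule that; assumption)
    obtain k2 where k2: "\<And>k. k2 \<le> k \<Longrightarrow> j \<le> k"
      "\<And>k. k2 \<le> k \<Longrightarrow> push J n k \<zeta> = push J j k \<zeta>'" "\<zeta>' \<in> vecs (V j)"
      using j by (rule lim_relD) (rule that; assumption)
    define k where "k = max k1 k2"
    have k: "n \<le> k" "m \<le> k" "push J n k \<eta> = push J i k \<eta>'" "push J n k \<zeta> = push J j k \<zeta>'"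
      "i \<le> m" "j \<le> m"
      using k1(1-3)[of k] k2(1,2)[of k] by (simp_all add: k_def m)
    have mem: "push J i m \<eta>' \<in> vecs (V m)" "push J j m \<zeta>' \<in> vecs (V m)"
      using k k1(4) k2(3) by (auto intro: pushD(1))
    show "((n, vadd (V n) \<eta> \<zeta>), (m, \<theta>)) \<in> lim_rel V J"
    proof (rule lim_relI)
      show "vadd (V n) \<eta> \<zeta> \<in> vecs (V n)" "\<theta> \<in> vecs (V m)"
        unfolding \<theta> by (intro semi_inner.add_mem[OF semi_inner_level] \<eta> \<zeta> mem)+
      show "push J n k (vadd (V n) \<eta> \<zeta>) = push J m k \<theta>"
        unfolding \<theta> pushD(2)[OF k(1) \<eta> \<zeta>] pushD(2)[OF k(2) mem]
        using k by (simp add: push_push)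
    qed (use k in auto)
  qed
  then show ?thesis by (simp add: ind_lim_def S_def)
qed

lemma vscale_germ:
  assumes \<eta>: "\<eta> \<in> vecs (V n)"
  shows "vscale (ind_lim V J) c (germ n \<eta>) = germ n (vscale (V n) c \<eta>)"
proof -
  define S where "S = {(i, vscale (V i) c \<eta>') | i \<eta>'. (i, \<eta>') \<in> germ n \<eta>}"
  have "lim_rel V J `` S = germ n (vscale (V n) c \<eta>)"
  proof (rule germ_eqI)
    show "S \<noteq> {}"
      using self_mem_germ \<eta> unfolding S_def by blast
  next
    fix m \<theta>
    assume "(m, \<theta>) \<in> S"
    then obtain \<eta>' where \<theta>: "\<theta> = vscale (V m) c \<eta>'" and i: "((n, \<eta>), (m, \<eta>')) \<in> lim_rel V J"
      unfolding S_def by (auto simp: mem_germ)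
    obtain k where k: "n \<le> k" "m \<le> k" "push J n k \<eta> = push J m k \<eta>'" "\<eta>' \<in> vecs (V m)"
      using i by (rule lim_relD) auto
    show "((n, vscale (V n) c \<eta>), (m, \<theta>)) \<in> lim_rel V J"
      unfolding \<theta> using k \<eta>
      by (intro lim_relI[where k = k] semi_inner.scale_mem[OF semi_inner_level]) (auto simp: pushD(3))
  qed
  then show ?thesis by (simp add: ind_lim_def S_def)
qed

lemma vinner_germ:
  assumes \<eta>: "\<eta> \<in> vecs (V n)" and \<zeta>: "\<zeta> \<in> vecs (V n)"
  shows "vinner (ind_lim V J) (germ n \<eta>) (germ n \<zeta>) = vinner (V n) \<eta> \<zeta>"
proof -
  have *: "vinner (V n) \<eta> \<zeta> = vinner (V (max i j)) (push J i (max i j) \<eta>') (push J j (max i j) \<zeta>')"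
    if i: "(i, \<eta>') \<in> germ n \<eta>" and j: "(j, \<zeta>') \<in> germ n \<zeta>" for i \<eta>' j \<zeta>'
  proof -
    obtain k1 where k1: "\<And>k. k1 \<le> k \<Longrightarrow> n \<le> k" "\<And>k. k1 \<le> k \<Longrightarrow> i \<le> k"
      "\<And>k. k1 \<le> k \<Longrightarrow> push J n k \<eta> = push J i k \<eta>'" "\<eta>' \<in> vecs (V i)"
      using i unfolding mem_germ by (rule lim_relD) (rule that; assumption)
    obtain k2 where k2: "\<And>k. k2 \<le> k \<Longrightarrow> j \<le> k"
      "\<And>k. k2 \<le> k \<Longrightarrow> push J n k \<zeta> = push J j k \<zeta>'" "\<zeta>' \<in> vecs (V j)"
      using j unfolding mem_germ by (rule lim_relD) (rule that; assumption)
    define k where "k = max k1 k2"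
    define m where "m = max i j"
    have k: "n \<le> k" "m \<le> k" "push J n k \<eta> = push J i k \<eta>'" "push J n k \<zeta> = push J j k \<zeta>'"
      "i \<le> m" "j \<le> m"
      using k1(1-3)[of k] k2(1,2)[of k] by (simp_all add: k_def m_def)
    have mem: "push J i m \<eta>' \<in> vecs (V m)" "push J j m \<zeta>' \<in> vecs (V m)"
      using k k1(4) k2(3) by (auto intro: pushD(1))
    have "vinner (V n) \<eta> \<zeta> = vinner (V k) (push J n k \<eta>) (push J n k \<zeta>)"
      by (rule pushD(4)[OF k(1) \<eta> \<zeta>, symmetric])
    also have "\<dots> = vinner (V k) (push J m k (push J i m \<eta>')) (push J m k (push J j m \<zeta>'))"
      using k by (simp add: push_push)
    also have "\<dots> = vinner (V m) (push J i m \<eta>') (push J j m \<zeta>')"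
      by (rule pushD(4)[OF k(2) mem])
    finally show ?thesis by (simp add: m_def)
  qed
  have "(THE z. \<forall>(i, \<eta>')\<in>germ n \<eta>. \<forall>(j, \<zeta>')\<in>germ n \<zeta>.
      z = vinner (V (max i j)) (push J i (max i j) \<eta>') (push J j (max i j) \<zeta>')) = vinner (V n) \<eta> \<zeta>"
  proof (rule the_equality)
    show "\<forall>(i, \<eta>')\<in>germ n \<eta>. \<forall>(j, \<zeta>')\<in>germ n \<zeta>.
      vinner (V n) \<eta> \<zeta> = vinner (V (max i j)) (push J i (max i j) \<eta>') (push J j (max i j) \<zeta>')"
      using * by blast
  next
    fix z
    assume "\<forall>(i, \<eta>')\<in>germ n \<eta>. \<forall>(j, \<zeta>')\<in>germ n \<zeta>.
      z = vinner (V (max i j)) (push J i (max i j) \<eta>') (push J j (max i j) \<zeta>')"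
    \<comment> \<open>The condition is evaluated at \<open>(n, \<eta>)\<close> and
      \<open>(n, \<zeta>)\<close> themselves, where both pushes are the identity.\<close>
    then show "z = vinner (V n) \<eta> \<zeta>"
      using self_mem_germ[OF \<eta>] self_mem_germ[OF \<zeta>] by fastforce
  qed
  then show ?thesis by (simp add: ind_lim_def)
qed

text \<open>Each axiom involves at most three elements; they are represented on one level, whose
  axioms then transfer.\<close>

lemma semi_inner_ind_lim: "semi_inner (ind_lim V J)"
proof
  fix A B C :: "(nat \<times> 'v) set" and c
  note level = semi_inner_level
  assume A: "A \<in> vecs (ind_lim V J)"
  then obtain n1 where n1: "\<And>n. n1 \<le> n \<Longrightarrow> \<exists>\<eta>\<in>vecs (V n). A = germ n \<eta>"
    by (rule vecs_ind_limE) blast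
  obtain n \<eta> where \<eta>: "\<eta> \<in> vecs (V n)" "A = germ n \<eta>"
    using n1[of n1] by auto
  show "vscale (ind_lim V J) c A \<in> vecs (ind_lim V J)"
    by (simp add: \<eta> vscale_germ germ_mem semi_inner.scale_mem[OF level])
  show "0 \<le> Re (vinner (ind_lim V J) A A)"
    by (simp add: \<eta> vinner_germ semi_inner.inner_self[OF level])
  assume B: "B \<in> vecs (ind_lim V J)"
  then obtain n2 where n2: "\<And>n. n2 \<le> n \<Longrightarrow> \<exists>\<eta>\<in>vecs (V n). B = germ n \<eta>"
    by (rule vecs_ind_limE) blast
  define l where "l = max n1 n2"
  obtain \<eta> \<zeta> where \<eta>: "\<eta> \<in> vecs (V l)" "A = germ l \<eta>" and \<zeta>: "\<zeta> \<in> vecs (V l)" "B = germ l \<zeta>"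
    using n1[of l] n2[of l] by (auto simp: l_def)
  show "vadd (ind_lim V J) A B \<in> vecs (ind_lim V J)"
    by (simp add: \<eta> \<zeta> vadd_germ germ_mem semi_inner.add_mem[OF level])
  show "vinner (ind_lim V J) (vscale (ind_lim V J) c A) B = c * vinner (ind_lim V J) A B"
    by (simp add: \<eta> \<zeta> vscale_germ vinner_germ semi_inner.scale_mem[OF level]
        semi_inner.inner_scale_left[OF level])
  show "vinner (ind_lim V J) B A = cnj (vinner (ind_lim V J) A B)"
    using semi_inner.inner_commute[OF level \<eta>(1) \<zeta>(1)] by (simp add: \<eta> \<zeta> vinner_germ)
  assume C: "C \<in> vecs (ind_lim V J)"
  then obtain n3 where n3: "\<And>n. n3 \<le> n \<Longrightarrow> \<exists>\<eta>\<in>vecs (V n). C = germ n \<eta>"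
    by (rule vecs_ind_limE) blast
  define m where "m = max n1 (max n2 n3)"
  then have ge: "n1 \<le> m" "n2 \<le> m" "n3 \<le> m" by auto
  obtain \<eta> \<zeta> \<theta> where \<eta>: "\<eta> \<in> vecs (V m)" "A = germ m \<eta>" and \<zeta>: "\<zeta> \<in> vecs (V m)" "B = germ m \<zeta>"
    and \<theta>: "\<theta> \<in> vecs (V m)" "C = germ m \<theta>"
    using n1[of m, OF ge(1)] n2[of m, OF ge(2)] n3[of m, OF ge(3)] by blast
  show "vinner (ind_lim V J) (vadd (ind_lim V J) A B) C =
      vinner (ind_lim V J) A C + vinner (ind_lim V J) B C"
    by (simp add: \<eta> \<zeta> \<theta> vadd_germ vinner_germ semi_inner.add_mem[OF level]
        semi_inner.inner_add_left[OF level])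
qed

section \<open>Maps induced on the inductive limit\<close>

text \<open>Representatives below level \<open>N\<close> are ignored, since an ampliation is
  compatible with the connecting maps only beyond the factors on which it acts. Every element still
  has representatives above \<open>N\<close>.\<close>

definition ind_map :: "nat \<Rightarrow> (nat \<Rightarrow> 'v \<Rightarrow> 'v) \<Rightarrow> (nat \<times> 'v) set \<Rightarrow> (nat \<times> 'v) set" where
  "ind_map N T A = lim_rel V J `` {(n, T n \<eta>) | n \<eta>. (n, \<eta>) \<in> A \<and> N \<le> n}"

context
  fixes N :: nat and T :: "nat \<Rightarrow> 'v \<Rightarrow> 'v"
  assumes T: "\<And>n. N \<le> n \<Longrightarrow> linear_isometry (V n) (V n) (T n)"
    and T_step: "\<And>n \<eta>. N \<le> n \<Longrightarrow> \<eta> \<in> vecs (V n) \<Longrightarrow> T (Suc n) (J n \<eta>) = J n (T n \<eta>)"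
begin

lemma push_commute:
  assumes "N \<le> n" "\<eta> \<in> vecs (V n)" "n \<le> m"
  shows "push J n m (T n \<eta>) = T m (push J n m \<eta>)"
  using assms(3) by (induction m rule: dec_induct) (use assms in \<open>simp_all add: push_Suc T_step pushD(1)\<close>)

lemma ind_map_germ:
  assumes "N \<le> n" "\<eta> \<in> vecs (V n)"
  shows "ind_map N T (germ n \<eta>) = germ n (T n \<eta>)"
  unfolding ind_map_def
proof (rule germ_eqI)
  show "{(m, T m \<zeta>) | m \<zeta>. (m, \<zeta>) \<in> germ n \<eta> \<and> N \<le> m} \<noteq> {}"
    using self_mem_germ assms by blast
next
  fix m \<theta>
  assume "(m, \<theta>) \<in> {(m, T m \<zeta>) | m \<zeta>. (m, \<zeta>) \<in> germ n \<eta> \<and> N \<le> m}"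
  then obtain \<zeta> where \<theta>: "\<theta> = T m \<zeta>" "N \<le> m" and rel: "((n, \<eta>), (m, \<zeta>)) \<in> lim_rel V J"
    by (auto simp: mem_germ)
  obtain k where k: "n \<le> k" "m \<le> k" "push J n k \<eta> = push J m k \<zeta>" "\<zeta> \<in> vecs (V m)"
    using rel by (rule lim_relD) auto
  show "((n, T n \<eta>), (m, \<theta>)) \<in> lim_rel V J"
    unfolding \<theta>(1) using k \<theta>(2) assms
    by (intro lim_relI[where k = k]) (auto simp: push_commute intro: linear_isometryD(1)[OF T])
qed

lemma linear_isometry_ind_map: "linear_isometry (ind_lim V J) (ind_lim V J) (ind_map N T)"
  unfolding linear_isometry_def
proof (intro conjI ballI allI)
  fix A B :: "(nat \<times> 'v) set" and c
  assume "A \<in> vecs (ind_lim V J)"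
  then obtain n1 where n1: "\<And>n. n1 \<le> n \<Longrightarrow> \<exists>\<eta>\<in>vecs (V n). A = germ n \<eta>"
    by (rule vecs_ind_limE) blast
  note level = semi_inner_level
  define n where "n = max N n1"
  obtain \<eta> where \<eta>: "N \<le> n" "\<eta> \<in> vecs (V n)" "A = germ n \<eta>"
    using n1[of n] by (auto simp: n_def)
  show "ind_map N T A \<in> vecs (ind_lim V J)"
    by (simp add: \<eta> ind_map_germ germ_mem linear_isometryD(1)[OF T])
  show "ind_map N T (vscale (ind_lim V J) c A) = vscale (ind_lim V J) c (ind_map N T A)"
    by (simp add: \<eta> ind_map_germ vscale_germ linear_isometryD(1,3)[OF T]
        semi_inner.scale_mem[OF level])
  assume "B \<in> vecs (ind_lim V J)"
  then obtain n2 where n2: "\<And>n. n2 \<le> n \<Longrightarrow> \<exists>\<eta>\<in>vecs (V n). B = germ n \<eta>"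
    by (rule vecs_ind_limE) blast
  define m where "m = max N (max n1 n2)"
  then have ge: "N \<le> m" "n1 \<le> m" "n2 \<le> m" by auto
  obtain \<eta> \<zeta> where \<eta>: "N \<le> m" "\<eta> \<in> vecs (V m)" "A = germ m \<eta>" and \<zeta>: "\<zeta> \<in> vecs (V m)" "B = germ m \<zeta>"
    using ge(1) n1[OF ge(2)] n2[OF ge(3)] by blast
  show "ind_map N T (vadd (ind_lim V J) A B) = vadd (ind_lim V J) (ind_map N T A) (ind_map N T B)"
    by (simp add: \<eta> \<zeta> ind_map_germ vadd_germ linear_isometryD(1,2)[OF T]
        semi_inner.add_mem[OF level])
  show "vinner (ind_lim V J) (ind_map N T A) (ind_map N T B) = vinner (ind_lim V J) A B"
    by (simp add: \<eta> \<zeta> ind_map_germ vinner_germ linear_isometryD(1,4)[OF T])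
qed

end

end


subsection \<open>Tensor powers\<close>

text \<open>Fubini for a product of two families: absolute summability over the product set allows
  iterated summation, after which constants are pulled out of each sum.\<close>

lemma infsum_product_abs_summable:
  fixes f :: "'a \<Rightarrow> complex" and g :: "'b \<Rightarrow> complex"
  assumes f: "(\<lambda>x. cmod (f x)) summable_on A" and g: "(\<lambda>y. cmod (g y)) summable_on B"
  shows "(\<lambda>p. cmod (case p of (x, y) \<Rightarrow> f x * g y)) summable_on A \<times> B"
    and "(\<Sum>\<^sub>\<infinity>(x, y)\<in>A \<times> B. f x * g y) = infsum f A * infsum g B"
proof -
  show abs: "(\<lambda>p. cmod (case p of (x, y) \<Rightarrow> f x * g y)) summable_on A \<times> B"
    unfolding Infinite_Sum.abs_summable_on_Sigma_iff
  proof
    show "\<forall>x\<in>A. (\<lambda>y. cmod (case (x, y) of (x, y) \<Rightarrow> f x * g y)) summable_on B"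
      using g by (auto simp: norm_mult intro: summable_on_cmult_right)
    have "(\<lambda>x. cmod (f x) * (\<Sum>\<^sub>\<infinity>y\<in>B. cmod (g y))) summable_on A"
      by (intro summable_on_cmult_left f)
    moreover have "0 \<le> (\<Sum>\<^sub>\<infinity>y\<in>B. cmod (g y))"
      by (intro infsum_nonneg) simp
    ultimately show "(\<lambda>x. norm (\<Sum>\<^sub>\<infinity>y\<in>B. cmod (case (x, y) of (x, y) \<Rightarrow> f x * g y))) summable_on A"
      by (simp add: norm_mult infsum_cmult_right' abs_mult)
  qed
  have "(\<Sum>\<^sub>\<infinity>(x, y)\<in>A \<times> B. f x * g y) = (\<Sum>\<^sub>\<infinity>x\<in>A. \<Sum>\<^sub>\<infinity>y\<in>B. f x * g y)"
    using Infinite_Sum.abs_summable_summable[OF abs] by (intro infsum_Sigma'_banach[symmetric]) auto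
  also have "\<dots> = infsum f A * infsum g B"
    by (simp add: infsum_cmult_right' infsum_cmult_left')
  finally show "(\<Sum>\<^sub>\<infinity>(x, y)\<in>A \<times> B. f x * g y) = infsum f A * infsum g B" .
qed

lemma ell2_simps:
  "vadd (ell2 A) f g = (\<lambda>x. f x + g x)"
  "vscale (ell2 A) c f = (\<lambda>x. c * f x)"
  "vinner (ell2 A) f g = (\<Sum>\<^sub>\<infinity>x\<in>A. f x * cnj (g x))"
  by (simp_all add: ell2_def)

lemma mem_ell2:
  "f \<in> vecs (ell2 A) \<longleftrightarrow> (\<forall>x. x \<notin> A \<longrightarrow> f x = 0) \<and> (\<lambda>x. (cmod (f x))\<^sup>2) summable_on A"
  by (simp add: ell2_def)

lemma ell2_inner_abs_summable:
  assumes "f \<in> vecs (ell2 A)" "g \<in> vecs (ell2 A)"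
  shows "(\<lambda>x. cmod (f x * cnj (g x))) summable_on A"
  using assms Infinite_Sum.abs_summable_product[of f A "\<lambda>x. cnj (g x)"]
  by (simp add: mem_ell2 norm_mult power2_eq_square)

lemma semi_inner_ell2: "semi_inner (ell2 A)"
proof
  fix f g h :: "'a \<Rightarrow> complex" and c
  assume f: "f \<in> vecs (ell2 A)"
  show "vscale (ell2 A) c f \<in> vecs (ell2 A)"
    using f by (auto simp: mem_ell2 ell2_simps norm_mult power_mult_distrib intro: summable_on_cmult_right)
  show "0 \<le> Re (vinner (ell2 A) f f)"
  proof -
    have "Re (vinner (ell2 A) f f) = (\<Sum>\<^sub>\<infinity>x\<in>A. Re (f x * cnj (f x)))"
      unfolding ell2_simps
      by (rule infsum_Re[OF Infinite_Sum.abs_summable_summable[OF ell2_inner_abs_summable[OF f f]], symmetric])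
    also have "0 \<le> \<dots>"
      by (intro infsum_nonneg) simp
    finally show ?thesis .
  qed
  assume g: "g \<in> vecs (ell2 A)"
  show "vadd (ell2 A) f g \<in> vecs (ell2 A)"
  proof -
    have "(\<lambda>x. 2 * (cmod (f x))\<^sup>2 + 2 * (cmod (g x))\<^sup>2) summable_on A"
      using f g by (intro summable_on_add summable_on_cmult_right) (auto simp: mem_ell2)
    moreover have "(cmod (f x + g x))\<^sup>2 \<le> 2 * (cmod (f x))\<^sup>2 + 2 * (cmod (g x))\<^sup>2" for x
    proof -
      have "(cmod (f x + g x))\<^sup>2 \<le> (cmod (f x) + cmod (g x))\<^sup>2"
        by (intro power_mono norm_triangle_ineq) simp
      also have "\<dots> \<le> 2 * (cmod (f x))\<^sup>2 + 2 * (cmod (g x))\<^sup>2"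
        using zero_le_power2[of "cmod (f x) - cmod (g x)"] by (simp add: power2_sum power2_diff)
      finally show ?thesis .
    qed
    ultimately have "(\<lambda>x. (cmod (f x + g x))\<^sup>2) summable_on A"
      by (rule summable_on_comparison_test) auto
    then show ?thesis
      using f g by (simp add: mem_ell2 ell2_simps)
  qed
  note summable = Infinite_Sum.abs_summable_summable[OF ell2_inner_abs_summable]
  show "vinner (ell2 A) (vscale (ell2 A) c f) g = c * vinner (ell2 A) f g"
    by (simp add: ell2_simps mult.assoc infsum_cmult_right')
  show "vinner (ell2 A) g f = cnj (vinner (ell2 A) f g)"
    by (simp add: ell2_simps mult.commute flip: infsum_cnj)
  assume h: "h \<in> vecs (ell2 A)"
  show "vinner (ell2 A) (vadd (ell2 A) f g) h = vinner (ell2 A) f h + vinner (ell2 A) g h"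
    using summable[OF f h] summable[OF g h] by (simp add: ell2_simps distrib_right infsum_add)
qed

lemma tensor_snoc_append [simp]: "tensor_snoc \<eta> v (xs @ [x]) = \<eta> xs * v x"
  by (simp add: tensor_snoc_def)

lemma tensor_snoc_Nil [simp]: "tensor_snoc \<eta> v [] = 0"
  by (simp add: tensor_snoc_def)

text \<open>Identifies the index set of level \<open>n + 1\<close> with a product, which turns sums
  over that level into double sums.\<close>

lemma bij_betw_snoc:
  "bij_betw (\<lambda>(xs, x). xs @ [x]) ({xs. length xs = n} \<times> UNIV) {xs. length xs = Suc n}"
  by (rule bij_betw_byWitness[where f' = "\<lambda>xs. (butlast xs, last xs)"]) (auto intro!: append_butlast_last_id)

lemma tensor_snoc_mem:
  assumes "\<eta> \<in> vecs (tensor_pow n)" "v \<in> vecs (ell2 UNIV)"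
  shows "tensor_snoc \<eta> v \<in> vecs (tensor_pow (Suc n))"
proof -
  \<comment> \<open>The squares are viewed as complex numbers because the product lemma concerns
    complex families.\<close>
  have "(\<lambda>p. cmod (case p of (xs, x) \<Rightarrow>
      complex_of_real ((cmod (\<eta> xs))\<^sup>2) * complex_of_real ((cmod (v x))\<^sup>2))) summable_on {xs. length xs = n} \<times> UNIV"
    using assms by (intro infsum_product_abs_summable) (simp_all add: tensor_pow_def mem_ell2 norm_power)
  then have "(\<lambda>p. (cmod (tensor_snoc \<eta> v ((\<lambda>(xs, x). xs @ [x]) p)))\<^sup>2) summable_on
      {xs. length xs = n} \<times> UNIV"
    by (rule summable_on_cong[THEN iffD1, rotated])
      (auto simp: norm_mult power_mult_distrib norm_power)
  then have "(\<lambda>xs. (cmod (tensor_snoc \<eta> v xs))\<^sup>2) summable_on {xs. length xs = Suc n}"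
    by (rule summable_on_reindex_bij_betw[OF bij_betw_snoc, THEN iffD1])
  moreover have "tensor_snoc \<eta> v xs = 0" if "length xs \<noteq> Suc n" for xs
    using assms(1) that by (cases xs rule: rev_cases) (auto simp: tensor_pow_def mem_ell2)
  ultimately show ?thesis
    by (simp add: tensor_pow_def mem_ell2)
qed

lemma vinner_tensor_snoc:
  assumes "\<eta> \<in> vecs (tensor_pow n)" "\<zeta> \<in> vecs (tensor_pow n)"
    and "v \<in> vecs (ell2 UNIV)" "w \<in> vecs (ell2 UNIV)"
  shows "vinner (tensor_pow (Suc n)) (tensor_snoc \<eta> v) (tensor_snoc \<zeta> w) =
    vinner (tensor_pow n) \<eta> \<zeta> * vinner (ell2 UNIV) v w"
proof -
  have "vinner (tensor_pow (Suc n)) (tensor_snoc \<eta> v) (tensor_snoc \<zeta> w) =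
      (\<Sum>\<^sub>\<infinity>p\<in>{xs. length xs = n} \<times> UNIV. tensor_snoc \<eta> v ((\<lambda>(xs, x). xs @ [x]) p) *
         cnj (tensor_snoc \<zeta> w ((\<lambda>(xs, x). xs @ [x]) p)))"
    unfolding tensor_pow_def ell2_simps
    by (rule infsum_reindex_bij_betw[OF bij_betw_snoc, symmetric])
  also have "\<dots> = (\<Sum>\<^sub>\<infinity>(xs, x)\<in>{xs. length xs = n} \<times> UNIV. (\<eta> xs * cnj (\<zeta> xs)) * (v x * cnj (w x)))"
    by (rule infsum_cong) (auto simp: mult_ac)
  also have "\<dots> = vinner (tensor_pow n) \<eta> \<zeta> * vinner (ell2 UNIV) v w"
    using assms by (simp add: infsum_product_abs_summable(2) ell2_inner_abs_summable
        tensor_pow_def ell2_simps)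
  finally show ?thesis .
qed

lemma linear_isometry_tensor_snoc:
  assumes "v \<in> vecs (ell2 UNIV)" "vinner (ell2 UNIV) v v = 1"
  shows "linear_isometry (tensor_pow n) (tensor_pow (Suc n)) (\<lambda>\<eta>. tensor_snoc \<eta> v)"
  unfolding linear_isometry_def using assms
  by (auto simp: tensor_snoc_mem vinner_tensor_snoc)
    (auto simp: tensor_pow_def ell2_simps tensor_snoc_def fun_eq_iff distrib_right)

lemma elem_tensor_mem:
  "(\<And>i. i < n \<Longrightarrow> v i \<in> vecs (ell2 UNIV)) \<Longrightarrow> elem_tensor v n \<in> vecs (tensor_pow n)"
proof (induction n)
  case 0
  have "(\<lambda>xs. (cmod (elem_tensor v 0 xs))\<^sup>2) summable_on {[]}"
    by (rule summable_on_finite) simp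
  then show ?case by (simp add: tensor_pow_def mem_ell2)
next
  case (Suc n)
  then show ?case by (simp add: tensor_snoc_mem)
qed


subsection \<open>Weighted permutation operators\<close>

definition weighted_perm :: "('a \<Rightarrow> complex) \<Rightarrow> ('a \<Rightarrow> 'a) \<Rightarrow> ('a \<Rightarrow> complex) \<Rightarrow> 'a \<Rightarrow> complex" where
  "weighted_perm c \<pi> f = (\<lambda>x. c x * f (\<pi> x))"

text \<open>A bijection only reindexes the sum, and the phases cancel in
  \<open>c x * cnj (c x) = 1\<close>. Members of \<open>ell2 A\<close> are functions on the whole
  type, and \<open>off\<close> ensures that the image again vanishes off \<open>A\<close>.\<close>

lemma linear_isometry_weighted_perm:
  assumes c: "\<And>x. x \<in> A \<Longrightarrow> cmod (c x) = 1" and \<pi>: "bij_betw \<pi> A A"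
    and off: "\<And>x. x \<notin> A \<Longrightarrow> \<pi> x \<notin> A"
  shows "linear_isometry (ell2 A) (ell2 A) (weighted_perm c \<pi>)"
proof -
  have "weighted_perm c \<pi> f \<in> vecs (ell2 A)" if "f \<in> vecs (ell2 A)" for f
  proof -
    have "(\<lambda>x. (cmod (f (\<pi> x)))\<^sup>2) summable_on A"
      using that summable_on_reindex_bij_betw[OF \<pi>, of "\<lambda>x. (cmod (f x))\<^sup>2"] by (simp add: mem_ell2)
    then have "(\<lambda>x. (cmod (weighted_perm c \<pi> f x))\<^sup>2) summable_on A"
      by (rule summable_on_cong[THEN iffD1, rotated]) (simp add: weighted_perm_def norm_mult c)
    then show ?thesis
      using that off by (simp add: mem_ell2 weighted_perm_def)
  qed
  moreover have "vinner (ell2 A) (weighted_perm c \<pi> f) (weighted_perm c \<pi> g) = vinner (ell2 A) f g" for f g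
  proof -
    have "c x * f (\<pi> x) * cnj (c x * g (\<pi> x)) = f (\<pi> x) * cnj (g (\<pi> x))" if "x \<in> A" for x
      using complex_norm_square[of "c x"] c[OF that] by (simp add: mult_ac)
    then have "vinner (ell2 A) (weighted_perm c \<pi> f) (weighted_perm c \<pi> g) =
        (\<Sum>\<^sub>\<infinity>x\<in>A. f (\<pi> x) * cnj (g (\<pi> x)))"
      unfolding ell2_simps weighted_perm_def by (intro infsum_cong)
    also have "\<dots> = vinner (ell2 A) f g"
      unfolding ell2_simps by (rule infsum_reindex_bij_betw[OF \<pi>])
    finally show ?thesis .
  qed
  ultimately show ?thesis
    unfolding linear_isometry_def by (simp add: ell2_simps weighted_perm_def distrib_left mult_ac)
qed

text \<open>The tensor product of the operators \<open>weighted_perm (c i) (\<pi> i)\<close>, simultaneously on all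
  tensor powers.\<close>

definition tensor_perm ::
  "(nat \<Rightarrow> 'a \<Rightarrow> complex) \<Rightarrow> (nat \<Rightarrow> 'a \<Rightarrow> 'a) \<Rightarrow> ('a list \<Rightarrow> complex) \<Rightarrow> 'a list \<Rightarrow> complex" where
  "tensor_perm c \<pi> = weighted_perm (\<lambda>xs. \<Prod>i<length xs. c i (xs ! i))
     (\<lambda>xs. map (\<lambda>i. \<pi> i (xs ! i)) [0..<length xs])"

lemma linear_isometry_tensor_perm:
  assumes c: "\<And>i x. cmod (c i x) = 1" and \<pi>: "\<And>i. bij (\<pi> i)"
  shows "linear_isometry (tensor_pow n) (tensor_pow n) (tensor_perm c \<pi>)"
  unfolding tensor_pow_def tensor_perm_def
proof (rule linear_isometry_weighted_perm)
  show "bij_betw (\<lambda>xs. map (\<lambda>i. \<pi> i (xs ! i)) [0..<length xs]) {xs. length xs = n} {xs. length xs = n}"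
    using \<pi> by (intro bij_betw_byWitness[where f' = "\<lambda>xs. map (\<lambda>i. inv (\<pi> i) (xs ! i)) [0..<length xs]"])
      (auto intro!: nth_equalityI simp: bij_is_inj bij_is_surj surj_f_inv_f)
qed (simp_all add: prod_norm[symmetric] c)

text \<open>Membership of \<open>\<eta>\<close> in level \<open>n\<close> fixes the position of the
  appended factor, so that \<open>c n\<close> and \<open>\<pi> n\<close> are the data applied to it.
  On lists whose initial part does not have length \<open>n\<close> both sides vanish.\<close>

lemma tensor_perm_snoc:
  assumes "\<eta> \<in> vecs (tensor_pow n)"
  shows "tensor_perm c \<pi> (tensor_snoc \<eta> v) =
    tensor_snoc (tensor_perm c \<pi> \<eta>) (weighted_perm (c n) (\<pi> n) v)"
proof
  fix xs
  show "tensor_perm c \<pi> (tensor_snoc \<eta> v) xs =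
    tensor_snoc (tensor_perm c \<pi> \<eta>) (weighted_perm (c n) (\<pi> n) v) xs"
  proof (cases xs rule: rev_cases)
    case Nil
    then show ?thesis by (simp add: tensor_perm_def weighted_perm_def)
  next
    case (snoc ys y)
    have map: "map (\<lambda>i. \<pi> i ((ys @ [y]) ! i)) [0..<length ys] = map (\<lambda>i. \<pi> i (ys ! i)) [0..<length ys]"
      by (simp add: nth_append)
    have prod: "(\<Prod>i<length ys. c i ((ys @ [y]) ! i)) = (\<Prod>i<length ys. c i (ys ! i))"
      by (simp add: nth_append)
    show ?thesis
    proof (cases "length ys = n")
      case True
      then show ?thesis
        by (simp add: snoc tensor_perm_def weighted_perm_def map prod flip: True)
    next
      case False
      then have "\<eta> (map (\<lambda>i. \<pi> i (ys ! i)) [0..<length ys]) = 0"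
        using assms by (simp add: tensor_pow_def mem_ell2)
      then show ?thesis
        by (simp add: snoc tensor_perm_def weighted_perm_def map)
    qed
  qed
qed

lemma tensor_perm_elem_tensor:
  assumes "\<And>i. i < n \<Longrightarrow> v i \<in> vecs (ell2 UNIV)"
  shows "tensor_perm c \<pi> (elem_tensor v n) = elem_tensor (\<lambda>i. weighted_perm (c i) (\<pi> i) (v i)) n"
  using assms
proof (induction n)
  case 0
  show ?case by (auto simp: tensor_perm_def weighted_perm_def fun_eq_iff)
next
  case (Suc n)
  then show ?case by (simp add: tensor_perm_snoc[OF elem_tensor_mem])
qed


subsection \<open>Infinite tensor products of weighted permutation operators\<close>

lemma (in semi_inner) inner_le_one:
  assumes "x \<in> vecs H" "y \<in> vecs H" "vinner H x x = 1" "vinner H y y = 1"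
  shows "cmod (vinner H x y) \<le> 1"
  using Cauchy_Schwarz[OF assms(1,2)] assms(3,4) by (simp add: vnorm_def)

locale weighted_perm_seq =
  fixes c :: "nat \<Rightarrow> 'a \<Rightarrow> complex" and \<pi> :: "nat \<Rightarrow> 'a \<Rightarrow> 'a" and \<psi> :: "nat \<Rightarrow> 'a \<Rightarrow> complex"
  assumes norm_weight: "cmod (c i x) = 1"
    and bij_perm: "bij (\<pi> i)"
    and unit_mem: "\<psi> i \<in> vecs (ell2 UNIV)"
    and unit_inner: "vinner (ell2 UNIV) (\<psi> i) (\<psi> i) = 1"
begin

sublocale isometric_system tensor_pow "\<lambda>n \<eta>. tensor_snoc \<eta> (\<psi> n)"
proof (rule isometric_system.intro)
  show "semi_inner (tensor_pow n :: ('a list \<Rightarrow> complex) ip_space)" for n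
    unfolding tensor_pow_def by (rule semi_inner_ell2)
  show "linear_isometry (tensor_pow n) (tensor_pow (Suc n)) (\<lambda>\<eta>. tensor_snoc \<eta> (\<psi> n))" for n
    by (rule linear_isometry_tensor_snoc[OF unit_mem unit_inner])
qed

sublocale fin: semi_inner "finite_tensors \<psi>"
  unfolding finite_tensors_def by (rule semi_inner_ind_lim)

interpretation single: semi_inner "ell2 (UNIV :: 'a set)"
  by (rule semi_inner_ell2)

section \<open>Operators on single factors and on tensor powers\<close>

text \<open>Off \<open>J\<close> the identity is written as a weighted permutation with trivial
  data, so that the general results on \<open>tensor_perm\<close> apply to every \<open>J\<close>
  without a case distinction.\<close>

definition factor_op :: "nat set \<Rightarrow> nat \<Rightarrow> ('a \<Rightarrow> complex) \<Rightarrow> 'a \<Rightarrow> complex" where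
  "factor_op J i = weighted_perm (if i \<in> J then c i else (\<lambda>_. 1)) (if i \<in> J then \<pi> i else id)"

lemma factor_op_in: "i \<in> J \<Longrightarrow> factor_op J i = weighted_perm (c i) (\<pi> i)"
  by (simp add: factor_op_def)

lemma factor_op_notin: "i \<notin> J \<Longrightarrow> factor_op J i v = v"
  by (simp add: factor_op_def weighted_perm_def)

lemma linear_isometry_factor_op: "linear_isometry (ell2 UNIV) (ell2 UNIV) (factor_op J i)"
  unfolding factor_op_def
  by (rule linear_isometry_weighted_perm) (simp_all add: norm_weight bij_perm)

definition level_op :: "nat set \<Rightarrow> ('a list \<Rightarrow> complex) \<Rightarrow> 'a list \<Rightarrow> complex" where
  "level_op J = tensor_perm (\<lambda>i. if i \<in> J then c i else (\<lambda>_. 1)) (\<lambda>i. if i \<in> J then \<pi> i else id)"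

lemma linear_isometry_level_op: "linear_isometry (tensor_pow n) (tensor_pow n) (level_op J)"
  unfolding level_op_def
  by (rule linear_isometry_tensor_perm) (simp_all add: norm_weight bij_perm)

lemma level_op_snoc:
  "\<eta> \<in> vecs (tensor_pow n) \<Longrightarrow>
    level_op J (tensor_snoc \<eta> v) = tensor_snoc (level_op J \<eta>) (factor_op J n v)"
  by (simp add: level_op_def factor_op_def tensor_perm_snoc)

lemma level_op_elem_tensor:
  "(\<And>i. i < n \<Longrightarrow> v i \<in> vecs (ell2 UNIV)) \<Longrightarrow>
    level_op J (elem_tensor v n) = elem_tensor (\<lambda>i. factor_op J i (v i)) n"
  by (simp add: level_op_def factor_op_def[abs_def] tensor_perm_elem_tensor)

text \<open>On lists of length \<open>n\<close> only the indices below \<open>n\<close> act, and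
  both sets contain all of them.\<close>

lemma level_op_cong:
  assumes "{..<n} \<subseteq> J" "{..<n} \<subseteq> K" "\<eta> \<in> vecs (tensor_pow n)"
  shows "level_op J \<eta> = level_op K \<eta>"
proof
  fix xs
  show "level_op J \<eta> xs = level_op K \<eta> xs"
  proof (cases "length xs = n")
    case True
    have *: "i \<in> J" "i \<in> K" if "i < length xs" for i
      using assms(1,2) that True by auto
    have "map (\<lambda>i. (if i \<in> J then \<pi> i else id) (xs ! i)) [0..<length xs] =
        map (\<lambda>i. (if i \<in> K then \<pi> i else id) (xs ! i)) [0..<length xs]"
      using * by (intro map_cong) auto
    moreover have "(\<Prod>i<length xs. (if i \<in> J then c i else (\<lambda>_. 1)) (xs ! i)) =
        (\<Prod>i<length xs. (if i \<in> K then c i else (\<lambda>_. 1)) (xs ! i))"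
      using * by (intro prod.cong) auto
    ultimately show ?thesis
      by (simp only: level_op_def tensor_perm_def weighted_perm_def)
  next
    case False
    then have "level_op L \<eta> xs = 0" for L
      using linear_isometryD(1)[OF linear_isometry_level_op assms(3), of L]
      by (simp add: tensor_pow_def mem_ell2)
    then show ?thesis by simp
  qed
qed

section \<open>Ampliations on the inductive limit\<close>

text \<open>For finite \<open>J\<close>, from the least level that covers \<open>J\<close> onwards
  every appended \<open>\<psi> n\<close> belongs to an index outside \<open>J\<close>. Hence
  \<open>level_op J\<close> commutes with the connecting maps there.\<close>

definition amplify :: "nat set \<Rightarrow> (nat \<times> ('a list \<Rightarrow> complex)) set \<Rightarrow> (nat \<times> ('a list \<Rightarrow> complex)) set" where
  "amplify J = ind_map (LEAST n. J \<subseteq> {..<n}) (\<lambda>_. level_op J)"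

context
  fixes J :: "nat set"
  assumes finite_J: "finite J"
begin

lemma subset_LEAST: "J \<subseteq> {..<LEAST n. J \<subseteq> {..<n}}"
  by (rule LeastI_ex) (use finite_J finite_nat_iff_bounded in blast)

lemma level_op_step:
  assumes "(LEAST n. J \<subseteq> {..<n}) \<le> n" "\<eta> \<in> vecs (tensor_pow n)"
  shows "level_op J (tensor_snoc \<eta> (\<psi> n)) = tensor_snoc (level_op J \<eta>) (\<psi> n)"
proof -
  have "n \<notin> J"
    using subset_LEAST assms(1) by (auto simp: subset_eq)
  then show ?thesis
    by (simp add: level_op_snoc[OF assms(2)] factor_op_notin)
qed

lemma amplify_germ:
  assumes "J \<subseteq> {..<n}" "\<eta> \<in> vecs (tensor_pow n)"
  shows "amplify J (germ n \<eta>) = germ n (level_op J \<eta>)"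
  unfolding amplify_def
  by (rule ind_map_germ[OF linear_isometry_level_op level_op_step Least_le[of "\<lambda>n. J \<subseteq> {..<n}", OF assms(1)] assms(2)])

lemma linear_isometry_amplify:
  "linear_isometry (finite_tensors \<psi>) (finite_tensors \<psi>) (amplify J)"
  unfolding amplify_def finite_tensors_def
  by (rule linear_isometry_ind_map[OF linear_isometry_level_op level_op_step])

lemma is_ampliation_amplify:
  "is_ampliation \<psi> (\<lambda>i. weighted_perm (c i) (\<pi> i)) J (fin.strong_limit (\<lambda>_. amplify J))"
  unfolding is_ampliation_def inf_tensor_def
proof (intro conjI allI impI)
  have cauchy: "\<And>x. x \<in> vecs (finite_tensors \<psi>) \<Longrightarrow> (\<lambda>_. amplify J x) \<in> cauchy_seqs (finite_tensors \<psi>)"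
    by (rule fin.const_cauchy) (rule linear_isometryD(1)[OF linear_isometry_amplify])
  show "bounded_operator (completion (finite_tensors \<psi>)) (fin.strong_limit (\<lambda>_. amplify J))"
    by (rule fin.bounded_operator_strong_limit[OF linear_isometry_amplify cauchy])
  fix n and v :: "nat \<Rightarrow> 'a \<Rightarrow> complex"
  assume n: "J \<subseteq> {..<n}" and v: "\<forall>i<n. v i \<in> vecs (ell2 UNIV)"
  have mem: "elem_tensor v n \<in> vecs (tensor_pow n)"
    using v by (intro elem_tensor_mem) simp
  have germ: "germ n (elem_tensor v n) \<in> vecs (finite_tensors \<psi>)"
    unfolding finite_tensors_def by (rule germ_mem[OF mem])
  have "fin.strong_limit (\<lambda>_. amplify J) (inf_tensor_embed \<psi> n (elem_tensor v n)) =
      fin.seq_class (\<lambda>_. amplify J (germ n (elem_tensor v n)))"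
    unfolding inf_tensor_embed_def
    by (rule fin.strong_limit_embed[OF linear_isometry_amplify cauchy germ])
  also have "\<dots> = inf_tensor_embed \<psi> n (level_op J (elem_tensor v n))"
    unfolding inf_tensor_embed_def amplify_germ[OF n mem] completion_embed_def fin.seq_class_def ..
  also have "level_op J (elem_tensor v n) =
      elem_tensor (\<lambda>i. if i \<in> J then weighted_perm (c i) (\<pi> i) (v i) else v i) n"
  proof -
    have "(\<lambda>i. factor_op J i (v i)) = (\<lambda>i. if i \<in> J then weighted_perm (c i) (\<pi> i) (v i) else v i)"
      by (auto simp: factor_op_in factor_op_notin)
    then show ?thesis
      using v by (simp add: level_op_elem_tensor)
  qed
  finally show "fin.strong_limit (\<lambda>_. amplify J) (inf_tensor_embed \<psi> n (elem_tensor v n)) =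
      inf_tensor_embed \<psi> n (elem_tensor (\<lambda>i. if i \<in> J then weighted_perm (c i) (\<pi> i) (v i) else v i) n)" .
qed

end

section \<open>Overlaps and the distance between two ampliations\<close>

definition overlap :: "nat \<Rightarrow> complex" where
  "overlap i = vinner (ell2 UNIV) (weighted_perm (c i) (\<pi> i) (\<psi> i)) (\<psi> i)"

text \<open>If \<open>i\<close> lies in both sets or in neither, \<open>q\<close> is 1; otherwise it
  is \<open>overlap i\<close> or its conjugate, which are equally far from 1. The value 0 for
  indices in both sets later restricts the sum to a tail.\<close>

lemma vinner_factor_op:
  fixes J K i
  defines "q \<equiv> vinner (ell2 UNIV) (factor_op J i (\<psi> i)) (factor_op K i (\<psi> i))"
  shows "cmod q \<le> 1" and "cmod (1 - q) \<le> (if i \<in> J \<and> i \<in> K then 0 else cmod (1 - overlap i))"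
proof -
  note mem = linear_isometryD(1)[OF linear_isometry_factor_op unit_mem]
  have unit: "vinner (ell2 UNIV) (factor_op L i (\<psi> i)) (factor_op L i (\<psi> i)) = 1" for L
    using linear_isometryD(4)[OF linear_isometry_factor_op unit_mem unit_mem] unit_inner by simp
  show "cmod q \<le> 1"
    unfolding q_def by (intro single.inner_le_one mem unit)
  consider "i \<in> J" "i \<in> K" | "i \<in> J" "i \<notin> K" | "i \<notin> J" "i \<in> K" | "i \<notin> J" "i \<notin> K"
    by blast
  then show "cmod (1 - q) \<le> (if i \<in> J \<and> i \<in> K then 0 else cmod (1 - overlap i))"
  proof cases
    case 1
    then have "q = 1"
      unfolding q_def using unit[of J] by (simp add: factor_op_in)
    then show ?thesis by simp
  next
    case 2
    then have "q = overlap i"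
      by (simp add: q_def overlap_def factor_op_in factor_op_notin)
    then show ?thesis using 2 by simp
  next
    case 3
    then have "q = cnj (overlap i)"
      using single.inner_commute[OF mem[of K i i] unit_mem[of i]]
      by (simp add: q_def overlap_def factor_op_in factor_op_notin)
    then have "cmod (1 - q) = cmod (1 - overlap i)"
      by (metis complex_cnj_diff complex_cnj_one complex_mod_cnj)
    then show ?thesis using 3 by simp
  next
    case 4
    then have "q = 1"
      by (simp add: q_def factor_op_notin unit_inner)
    then show ?thesis by simp
  qed
qed

text \<open>Each appended \<open>\<psi> i\<close> contributes one factor to the inner product. At
  level \<open>n\<close> itself the two operators coincide and are isometric, which gives the inner
  product of \<open>\<eta>\<close> with itself.\<close>

lemma vinner_level_op_push:
  assumes "{..<n} \<subseteq> J" "{..<n} \<subseteq> K" and \<eta>: "\<eta> \<in> vecs (tensor_pow n)" and "n \<le> m"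
  shows "vinner (tensor_pow m) (level_op J (push (\<lambda>n \<eta>. tensor_snoc \<eta> (\<psi> n)) n m \<eta>))
      (level_op K (push (\<lambda>n \<eta>. tensor_snoc \<eta> (\<psi> n)) n m \<eta>)) =
    vinner (tensor_pow n) \<eta> \<eta> *
      (\<Prod>i=n..<m. vinner (ell2 UNIV) (factor_op J i (\<psi> i)) (factor_op K i (\<psi> i)))"
  using \<open>n \<le> m\<close>
proof (induction m rule: dec_induct)
  case base
  show ?case
    using level_op_cong[OF assms(1,2) \<eta>] linear_isometryD(4)[OF linear_isometry_level_op \<eta> \<eta>, of K]
    by simp
next
  case (step m)
  note mem = pushD(1)[OF step.hyps(1) \<eta>]
  show ?case
    using step.hyps
    by (simp add: push_Suc level_op_snoc[OF mem] vinner_tensor_snoc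
        linear_isometryD(1)[OF linear_isometry_level_op mem]
        linear_isometryD(1)[OF linear_isometry_factor_op unit_mem] step.IH)
qed

context
  assumes summable_overlap: "summable (\<lambda>i. cmod (1 - overlap i))"
begin

text \<open>Summability of \<open>cmod (1 - overlap i)\<close> controls
  \<open>\<parallel>weighted_perm (c i) (\<pi> i) (\<psi> i) - \<psi> i\<parallel>\<close> only square-summably; a telescoping estimate over the
  factors would therefore fail, and the product formula for the inner product is used instead.\<close>

lemma vdist_amplify_le:
  assumes x: "x \<in> vecs (finite_tensors \<psi>)"
  obtains M0 where "\<And>M J K. M0 \<le> M \<Longrightarrow> finite J \<Longrightarrow> finite K \<Longrightarrow> {..<M} \<subseteq> J \<Longrightarrow> {..<M} \<subseteq> K \<Longrightarrow>
    (vdist (finite_tensors \<psi>) (amplify J x) (amplify K x))\<^sup>2 \<le>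
      2 * (vnorm (finite_tensors \<psi>) x)\<^sup>2 * (\<Sum>i. cmod (1 - overlap (i + M)))"
proof -
  obtain n0 where n0: "\<And>n. n0 \<le> n \<Longrightarrow> \<exists>\<eta>\<in>vecs (tensor_pow n). x = germ n \<eta>"
    using x unfolding finite_tensors_def by (rule vecs_ind_limE) blast
  then obtain \<eta> where \<eta>: "\<eta> \<in> vecs (tensor_pow n0)" "x = germ n0 \<eta>"
    by blast
  show thesis
  proof (rule that)
    fix M J K
    assume M: "n0 \<le> M" and J: "finite J" "{..<M} \<subseteq> J" and K: "finite K" "{..<M} \<subseteq> K"
    obtain m where m: "J \<union> K \<subseteq> {..<m}"
      using J K finite_nat_iff_bounded[of "J \<union> K"] by auto
    \<comment> \<open>At this level both ampliations act through \<open>level_op\<close>; it also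
      lies beyond \<open>M\<close>, where the tail begins.\<close>
    define m' where "m' = max m M"
    have m': "J \<subseteq> {..<m'}" "K \<subseteq> {..<m'}" "M \<le> m'" "n0 \<le> m'"
      using m M by (auto simp: m'_def subset_eq less_max_iff_disj)
    define \<zeta> where "\<zeta> = push (\<lambda>n \<eta>. tensor_snoc \<eta> (\<psi> n)) n0 m' \<eta>"
    have \<zeta>: "\<zeta> \<in> vecs (tensor_pow m')" "x = germ m' \<zeta>"
      unfolding \<zeta>_def using pushD(1)[OF m'(4) \<eta>(1)] germ_push[OF \<eta>(1) m'(4)] \<eta>(2) by simp_all
    define q where "q i = vinner (ell2 UNIV) (factor_op J i (\<psi> i)) (factor_op K i (\<psi> i))" for i
    define P where "P = (\<Prod>i=n0..<m'. q i)"
    have J0: "{..<n0} \<subseteq> J" and K0: "{..<n0} \<subseteq> K"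
      using J K M by auto
    have "vinner (finite_tensors \<psi>) (amplify J x) (amplify K x) =
        vinner (tensor_pow m') (level_op J \<zeta>) (level_op K \<zeta>)"
      unfolding \<zeta>(2) amplify_germ[OF J(1) m'(1) \<zeta>(1)] amplify_germ[OF K(1) m'(2) \<zeta>(1)]
        finite_tensors_def
      by (rule vinner_germ) (rule linear_isometryD(1)[OF linear_isometry_level_op \<zeta>(1)])+
    also have "\<dots> = vinner (tensor_pow n0) \<eta> \<eta> * P"
      unfolding \<zeta>_def P_def q_def by (rule vinner_level_op_push[OF J0 K0 \<eta>(1) m'(4)])
    also have "vinner (tensor_pow n0) \<eta> \<eta> = vinner (finite_tensors \<psi>) x x"
      unfolding \<eta>(2) finite_tensors_def by (rule vinner_germ[OF \<eta>(1) \<eta>(1), symmetric])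
    also have "\<dots> = complex_of_real ((vnorm (finite_tensors \<psi>) x)\<^sup>2)"
      by (rule fin.inner_self_eq[OF x])
    finally have inner: "Re (vinner (finite_tensors \<psi>) (amplify J x) (amplify K x)) =
        (vnorm (finite_tensors \<psi>) x)\<^sup>2 * Re P"
      by (simp del: of_real_power)
    note iso = linear_isometry_amplify[OF J(1)] linear_isometry_amplify[OF K(1)]
    \<comment> \<open>Both images have the norm of \<open>x\<close>, so the expanded square depends
      only on the real part of their inner product.\<close>
    have "(vdist (finite_tensors \<psi>) (amplify J x) (amplify K x))\<^sup>2 =
        2 * (vnorm (finite_tensors \<psi>) x)\<^sup>2 * (1 - Re P)"
      by (simp add: fin.vdist_square linear_isometryD(1)[OF iso(1) x] linear_isometryD(1)[OF iso(2) x]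
          linear_isometryD(5)[OF iso(1) x] linear_isometryD(5)[OF iso(2) x] inner algebra_simps)
    also have "\<dots> \<le> 2 * (vnorm (finite_tensors \<psi>) x)\<^sup>2 * (\<Sum>i. cmod (1 - overlap (i + M)))"
    proof (rule mult_left_mono)
      have "1 - Re P \<le> cmod (1 - P)"
        using complex_Re_le_cmod[of "1 - P"] by simp
      \<comment> \<open>Products of numbers of modulus at most 1 differ by at most the sum of the
        differences of their factors.\<close>
      also have "\<dots> \<le> (\<Sum>i=n0..<m'. cmod (1 - q i))"
        using norm_prod_diff[of "{n0..<m'}" "\<lambda>_. 1" q] vinner_factor_op(1)
        by (simp add: P_def q_def)
      \<comment> \<open>Indices below \<open>M\<close> lie in both \<open>J\<close> and
        \<open>K\<close>, so only the tail from \<open>M\<close> on survives.\<close>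
      also have "\<dots> \<le> (\<Sum>i=n0..<m'. if i < M then 0 else cmod (1 - overlap i))"
      proof (rule sum_mono)
        fix i
        have "cmod (1 - q i) \<le> (if i \<in> J \<and> i \<in> K then 0 else cmod (1 - overlap i))"
          unfolding q_def by (rule vinner_factor_op(2))
        also have "\<dots> \<le> (if i < M then 0 else cmod (1 - overlap i))"
          using J(2) K(2) by auto
        finally show "cmod (1 - q i) \<le> (if i < M then 0 else cmod (1 - overlap i))" .
      qed
      also have "\<dots> = (\<Sum>i=M..<m'. cmod (1 - overlap i))"
        using M by (intro sum.mono_neutral_cong_right) auto
      also have "\<dots> = (\<Sum>i<m' - M. cmod (1 - overlap (i + M)))"
        using m'(3) by (intro sum.reindex_bij_witness[of _ "\<lambda>i. i + M" "\<lambda>i. i - M"]) auto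
      also have "\<dots> \<le> (\<Sum>i. cmod (1 - overlap (i + M)))"
        using summable_ignore_initial_segment[OF summable_overlap] by (intro sum_le_suminf) auto
      finally show "1 - Re P \<le> (\<Sum>i. cmod (1 - overlap (i + M)))" .
    qed simp
    finally show "(vdist (finite_tensors \<psi>) (amplify J x) (amplify K x))\<^sup>2 \<le>
      2 * (vnorm (finite_tensors \<psi>) x)\<^sup>2 * (\<Sum>i. cmod (1 - overlap (i + M)))" .
  qed
qed

lemma vdist_amplify_less:
  assumes x: "x \<in> vecs (finite_tensors \<psi>)" and e: "0 < e"
  obtains M where "\<And>J K. finite J \<Longrightarrow> finite K \<Longrightarrow> {..<M} \<subseteq> J \<Longrightarrow> {..<M} \<subseteq> K \<Longrightarrow>
    vdist (finite_tensors \<psi>) (amplify J x) (amplify K x) < e"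
proof -
  define C where "C = 2 * (vnorm (finite_tensors \<psi>) x)\<^sup>2"
  have C: "0 \<le> C"
    by (simp add: C_def)
  obtain M0 where M0: "\<And>M J K. M0 \<le> M \<Longrightarrow> finite J \<Longrightarrow> finite K \<Longrightarrow> {..<M} \<subseteq> J \<Longrightarrow> {..<M} \<subseteq> K \<Longrightarrow>
    (vdist (finite_tensors \<psi>) (amplify J x) (amplify K x))\<^sup>2 \<le> C * (\<Sum>i. cmod (1 - overlap (i + M)))"
    unfolding C_def using vdist_amplify_le[OF x] by blast
  \<comment> \<open>The denominator is \<open>C + 1\<close> and not \<open>C\<close> because the
    norm of \<open>x\<close> may be zero.\<close>
  have "0 < e\<^sup>2 / (C + 1)"
    using C e by (intro divide_pos_pos) auto
  from suminf_exist_split[OF this summable_overlap]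
  obtain M1 where M1: "\<And>M. M1 \<le> M \<Longrightarrow> norm (\<Sum>i. cmod (1 - overlap (i + M))) < e\<^sup>2 / (C + 1)"
    by blast
  define M where "M = max M0 M1"
  define t where "t = (\<Sum>i. cmod (1 - overlap (i + M)))"
  have t: "0 \<le> t" "t < e\<^sup>2 / (C + 1)"
    using M1[of M] summable_ignore_initial_segment[OF summable_overlap, of M]
    by (auto simp: t_def M_def intro!: suminf_nonneg)
  have "vdist (finite_tensors \<psi>) (amplify J x) (amplify K x) < e"
    if "finite J" "finite K" "{..<M} \<subseteq> J" "{..<M} \<subseteq> K" for J K
  proof (rule power_less_imp_less_base)
    have "(vdist (finite_tensors \<psi>) (amplify J x) (amplify K x))\<^sup>2 \<le> C * t"
      unfolding t_def using that by (intro M0) (auto simp: M_def)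
    also have "\<dots> \<le> (C + 1) * t"
      using t by (intro mult_right_mono) auto
    also have "\<dots> < e\<^sup>2"
      using t C by (simp add: pos_less_divide_eq mult.commute)
    finally show "(vdist (finite_tensors \<psi>) (amplify J x) (amplify K x))\<^sup>2 < e\<^sup>2" .
  qed (use e in simp)
  then show thesis by (rule that)
qed

text \<open>The completion is built from sequences, so the limit operator is constructed along the
  initial segments \<open>{..<k}\<close>. The estimate for arbitrary finite sets containing
  \<open>{..<M}\<close> then shows that the full net has the same limit.\<close>

theorem tensor_op_exists_weighted_perm:
  "tensor_op_exists \<psi> (\<lambda>i. weighted_perm (c i) (\<pi> i))"
proof -
  define T where "T k = amplify {..<k}" for k
  have T: "linear_isometry (finite_tensors \<psi>) (finite_tensors \<psi>) (T k)" for k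
    unfolding T_def by (rule linear_isometry_amplify) simp
  have T_cauchy: "(\<lambda>k. T k x) \<in> cauchy_seqs (finite_tensors \<psi>)"
    if x: "x \<in> vecs (finite_tensors \<psi>)" for x
    unfolding cauchy_seqs_def
  proof (intro CollectI conjI allI impI)
    show "T k x \<in> vecs (finite_tensors \<psi>)" for k
      by (rule linear_isometryD(1)[OF T x])
    fix e :: real
    assume "0 < e"
    with x obtain M where M: "\<And>J K. finite J \<Longrightarrow> finite K \<Longrightarrow> {..<M} \<subseteq> J \<Longrightarrow> {..<M} \<subseteq> K \<Longrightarrow>
        vdist (finite_tensors \<psi>) (amplify J x) (amplify K x) < e"
      by (rule vdist_amplify_less) blast
    show "\<exists>M. \<forall>m\<ge>M. \<forall>n\<ge>M. vdist (finite_tensors \<psi>) (T m x) (T n x) < e"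
      unfolding T_def by (intro exI[of _ M] allI impI M) auto
  qed
  have "sot_tendsto (completion (finite_tensors \<psi>)) (\<lambda>J. fin.strong_limit (\<lambda>_. amplify J))
      (fin.strong_limit T) (finite_subsets_at_top UNIV)"
  proof (rule fin.sot_tendsto_strong_limit[OF T T_cauchy])
    show "\<forall>\<^sub>F J in finite_subsets_at_top UNIV.
        linear_isometry (finite_tensors \<psi>) (finite_tensors \<psi>) (amplify J)"
      by (rule eventually_finite_subsets_at_top_weakI) (rule linear_isometry_amplify)
    fix x and e :: real
    assume "x \<in> vecs (finite_tensors \<psi>)" "0 < e"
    then obtain M where M: "\<And>J K. finite J \<Longrightarrow> finite K \<Longrightarrow> {..<M} \<subseteq> J \<Longrightarrow> {..<M} \<subseteq> K \<Longrightarrow>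
        vdist (finite_tensors \<psi>) (amplify J x) (amplify K x) < e"
      by (rule vdist_amplify_less) blast
    have "\<forall>\<^sub>F k in sequentially. vdist (finite_tensors \<psi>) (amplify J x) (T k x) < e"
      if "finite J" "{..<M} \<subseteq> J" for J
      unfolding T_def using eventually_ge_at_top[of M] by eventually_elim (use that in \<open>auto intro: M\<close>)
    then show "\<forall>\<^sub>F J in finite_subsets_at_top UNIV.
        \<forall>\<^sub>F k in sequentially. vdist (finite_tensors \<psi>) (amplify J x) (T k x) < e"
      unfolding eventually_finite_subsets_at_top by (intro exI[of _ "{..<M}"]) auto
  qed
  moreover have "bounded_operator (completion (finite_tensors \<psi>)) (fin.strong_limit T)"
    by (rule fin.bounded_operator_strong_limit[OF T T_cauchy])
  ultimately show ?thesis
    unfolding tensor_op_exists_def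
    by (intro exI[of _ "\<lambda>J. fin.strong_limit (\<lambda>_. amplify J)"] exI[of _ "fin.strong_limit T"])
      (auto simp: inf_tensor_def intro: is_ampliation_amplify)
qed

end

end


subsection \<open>Translates of boxes\<close>

lemma bij_betw_vec_nth_PiE:
  "bij_betw vec_nth {b :: 'b ^ 'q. \<forall>k. b $ k \<in> B k} (PiE UNIV B)"
  by (rule bij_betw_byWitness[where f' = vec_lambda]) (auto simp: PiE_iff)

lemma card_vec_box: "card {b :: 'b ^ 'q. \<forall>k. b $ k \<in> B k} = (\<Prod>k\<in>UNIV. card (B k))"
  using bij_betw_same_card[OF bij_betw_vec_nth_PiE[of B]] by (simp add: card_PiE)

lemma int_box_eq: "int_box n = {b :: int ^ 'q. \<forall>k. b $ k \<in> {0..int n}}"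
  by (simp add: int_box_def)

lemma finite_int_box: "finite (int_box n :: (int ^ 'q) set)"
proof -
  have "finite (PiE (UNIV :: 'q set) (\<lambda>_. {0..int n}))"
    by (intro finite_PiE) auto
  then show ?thesis
    unfolding int_box_eq using bij_betw_finite[OF bij_betw_vec_nth_PiE, of "\<lambda>_ :: 'q. {0..int n}"]
    by (simp only:)
qed

lemma card_int_box: "card (int_box n :: (int ^ 'q) set) = (n + 1) ^ CARD('q)"
  unfolding int_box_eq card_vec_box by (simp add: nat_add_distrib)

text \<open>Restricting one coordinate to \<open>S\<close> leaves the others free, so the slab is
  the fraction \<open>card S / (n + 1)\<close> of the box. The cross-multiplied form keeps the count
  in the natural numbers.\<close>

lemma card_int_box_slab:
  assumes "S \<subseteq> {0..int n}"
  shows "card {b \<in> int_box n :: (int ^ 'q) set. b $ k \<in> S} * (n + 1) =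
    card S * card (int_box n :: (int ^ 'q) set)"
proof -
  have "{b \<in> int_box n :: (int ^ 'q) set. b $ k \<in> S} = {b. \<forall>j. b $ j \<in> (if j = k then S else {0..int n})}"
  proof (intro Collect_cong iffI allI)
    fix b :: "int ^ 'q" and j
    assume "b \<in> int_box n \<and> b $ k \<in> S"
    then show "b $ j \<in> (if j = k then S else {0..int n})"
      by (simp add: int_box_eq)
  next
    fix b :: "int ^ 'q"
    assume b: "\<forall>j. b $ j \<in> (if j = k then S else {0..int n})"
    have "b $ j \<in> {0..int n}" for j
      using spec[OF b, of j] assms by (cases "j = k") auto
    moreover have "b $ k \<in> S"
      using spec[OF b, of k] by simp
    ultimately show "b \<in> int_box n \<and> b $ k \<in> S"
      by (simp add: int_box_eq)
  qed
  then have "card {b \<in> int_box n :: (int ^ 'q) set. b $ k \<in> S} =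
      (\<Prod>j\<in>(UNIV :: 'q set). card (if j = k then S else {0..int n}))"
    by (simp only: card_vec_box)
  also have "\<dots> = card S * (\<Prod>j\<in>UNIV - {k}. n + 1)"
    by (subst prod.remove[of _ k]) (auto intro!: prod.cong simp: nat_add_distrib)
  finally have "card {b \<in> int_box n :: (int ^ 'q) set. b $ k \<in> S} = card S * (\<Prod>j\<in>UNIV - {k}. n + 1)" .
  moreover have "card (int_box n :: (int ^ 'q) set) = (n + 1) * (\<Prod>j\<in>UNIV - {k}. n + 1)"
    unfolding int_box_eq card_vec_box
    by (subst prod.remove[of _ k]) (auto simp: nat_add_distrib)
  ultimately show ?thesis by (simp only: mult_ac)
qed

text \<open>A point leaves the interval under translation only if it is below \<open>\<beta>\<close>
  or above \<open>n + \<beta>\<close>.\<close>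

lemma card_interval_minus_translate:
  "int (card {t \<in> {0..int n}. t - \<beta> \<notin> {0..int n}}) \<le> \<bar>\<beta>\<bar>"
proof -
  have "{t \<in> {0..int n}. t - \<beta> \<notin> {0..int n}} \<subseteq> {0..<\<beta>} \<union> {int n + \<beta><..int n}"
    by auto
  then have "card {t \<in> {0..int n}. t - \<beta> \<notin> {0..int n}} \<le> card ({0..<\<beta>} \<union> {int n + \<beta><..int n})"
    by (intro card_mono) auto
  also have "\<dots> \<le> card {0..<\<beta>} + card {int n + \<beta><..int n}"
    by (rule card_Un_le)
  \<comment> \<open>At most one of the two summands is non-zero, so their sum is the absolute value
    of \<open>\<beta>\<close>.\<close>
  also have "\<dots> = nat \<beta> + nat (- \<beta>)"
    by simp
  finally show ?thesis by linarith
qed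

text \<open>A translated point leaves the box only if some coordinate leaves its interval; the union
  bound over the coordinates reduces the count to slabs.\<close>

lemma card_int_box_minus_translate:
  fixes b0 :: "int ^ 'q"
  shows "real (card {b \<in> int_box n. b - b0 \<notin> int_box n}) / real (card (int_box n :: (int ^ 'q) set)) \<le>
    (\<Sum>k\<in>UNIV. \<bar>real_of_int (b0 $ k)\<bar>) / (real n + 1)"
proof -
  define S where "S k = {t \<in> {0..int n}. t - b0 $ k \<notin> {0..int n}}" for k
  define N where "N = card (int_box n :: (int ^ 'q) set)"
  have N: "0 < N"
    by (simp add: N_def card_int_box)
  have "{b \<in> int_box n. b - b0 \<notin> int_box n} \<subseteq> (\<Union>k\<in>UNIV. {b \<in> int_box n. b $ k \<in> S k})"
    by (auto simp: int_box_def S_def)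
  then have "card {b \<in> int_box n. b - b0 \<notin> int_box n} \<le> card (\<Union>k\<in>UNIV. {b \<in> int_box n. b $ k \<in> S k})"
    by (intro card_mono) (auto simp: finite_int_box)
  also have "\<dots> \<le> (\<Sum>k\<in>UNIV. card {b \<in> int_box n. b $ k \<in> S k})"
    by (rule card_UN_le) simp
  finally have "real (card {b \<in> int_box n. b - b0 \<notin> int_box n}) \<le>
      (\<Sum>k\<in>UNIV. real (card {b \<in> int_box n :: (int ^ 'q) set. b $ k \<in> S k}))"
    by (simp flip: of_nat_sum)
  also have "\<dots> \<le> (\<Sum>k\<in>UNIV. \<bar>real_of_int (b0 $ k)\<bar> * real N / (real n + 1))"
  proof (rule sum_mono)
    fix k
    have "real (card {b \<in> int_box n :: (int ^ 'q) set. b $ k \<in> S k}) * (real n + 1) = real (card (S k)) * real N"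
    proof -
      have "card {b \<in> int_box n :: (int ^ 'q) set. b $ k \<in> S k} * (n + 1) = card (S k) * N"
        unfolding N_def by (rule card_int_box_slab) (auto simp: S_def)
      from arg_cong[OF this, of real] show ?thesis
        by (simp only: of_nat_mult of_nat_add of_nat_1)
    qed
    also have "\<dots> \<le> \<bar>real_of_int (b0 $ k)\<bar> * real N"
      using card_interval_minus_translate[of n "b0 $ k"]
      unfolding S_def by (intro mult_right_mono) linarith+
    finally show "real (card {b \<in> int_box n :: (int ^ 'q) set. b $ k \<in> S k}) \<le>
        \<bar>real_of_int (b0 $ k)\<bar> * real N / (real n + 1)"
      by (simp add: pos_le_divide_eq)
  qed
  also have "\<dots> = (\<Sum>k\<in>UNIV. \<bar>real_of_int (b0 $ k)\<bar>) / (real n + 1) * real N"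
    by (simp add: sum_distrib_right sum_divide_distrib)
  finally show ?thesis
    using N by (simp add: N_def pos_divide_le_eq)
qed

section \<open>Box vectors and their overlaps with weighted translates\<close>

lemma infsum_finite_support:
  assumes "finite B" "\<And>x. x \<notin> B \<Longrightarrow> f x = 0"
  shows "infsum f UNIV = sum f B"
proof -
  have "infsum f UNIV = infsum f B"
    by (rule infsum_cong_neutral) (use assms in auto)
  then show ?thesis using assms(1) by simp
qed

lemma box_vec_eq: "box_vec n b =
    (if b \<in> int_box n then complex_of_real (1 / sqrt (real (card (int_box n :: (int ^ 'q) set)))) else 0)"
  for b :: "int ^ 'q"
  by (simp add: box_vec_def)

lemma box_vec_mult:
  fixes b b' :: "int ^ 'q"
  shows "box_vec n b * cnj (box_vec n b') =
    (if b \<in> int_box n \<and> b' \<in> int_box n then 1 / of_nat (card (int_box n :: (int ^ 'q) set)) else 0)"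
  by (simp add: box_vec_eq flip: of_real_mult)

lemma box_vec_mem: "box_vec n \<in> vecs (ell2 (UNIV :: (int ^ 'q) set))"
proof -
  have "(\<lambda>b. (cmod (box_vec n b))\<^sup>2) summable_on (int_box n :: (int ^ 'q) set)"
    by (rule summable_on_finite[OF finite_int_box])
  then have "(\<lambda>b. (cmod (box_vec n b))\<^sup>2) summable_on (UNIV :: (int ^ 'q) set)"
    by (rule summable_on_cong_neutral[THEN iffD1, rotated -1]) (auto simp: box_vec_eq)
  then show ?thesis by (simp add: mem_ell2)
qed

lemma vinner_box_vec: "vinner (ell2 (UNIV :: (int ^ 'q) set)) (box_vec n) (box_vec n) = 1"
proof -
  have "card (int_box n :: (int ^ 'q) set) \<noteq> 0"
    by (simp add: card_int_box)
  then show ?thesis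
    unfolding ell2_simps box_vec_mult
    by (subst infsum_finite_support[OF finite_int_box]) auto
qed

text \<open>The inner product is the average over the box of \<open>c b\<close>, with
  \<open>c b\<close> replaced by 0 at points whose translate leaves the box. The remaining points
  cost at most \<open>r\<close> each, and the proportion of lost points is bounded by the count of
  the boundary slabs.\<close>

lemma norm_one_minus_overlap_le:
  fixes c :: "int ^ 'q \<Rightarrow> complex" and b0 :: "int ^ 'q"
  assumes c: "\<And>b. b \<in> int_box n \<Longrightarrow> cmod (1 - c b) \<le> r"
  shows "cmod (1 - vinner (ell2 UNIV) (weighted_perm c (\<lambda>b. b - b0) (box_vec n)) (box_vec n)) \<le>
    r + (\<Sum>k\<in>UNIV. \<bar>real_of_int (b0 $ k)\<bar>) / (real n + 1)"
proof -
  define N where "N = card (int_box n :: (int ^ 'q) set)"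
  have N: "0 < N"
    by (simp add: N_def card_int_box)
  let ?B = "int_box n :: (int ^ 'q) set"
  have "vinner (ell2 UNIV) (weighted_perm c (\<lambda>b. b - b0) (box_vec n)) (box_vec n) =
      (\<Sum>\<^sub>\<infinity>b. c b * (box_vec n (b - b0) * cnj (box_vec n b)))"
    by (simp add: ell2_simps weighted_perm_def mult.assoc)
  also have "\<dots> = (\<Sum>b\<in>?B. c b * (box_vec n (b - b0) * cnj (box_vec n b)))"
    by (rule infsum_finite_support[OF finite_int_box]) (simp add: box_vec_eq)
  also have "\<dots> = (\<Sum>b\<in>?B. (if b - b0 \<in> ?B then c b else 0)) / of_nat N"
    unfolding box_vec_mult sum_divide_distrib by (intro sum.cong) (auto simp: N_def)
  finally have "1 - vinner (ell2 UNIV) (weighted_perm c (\<lambda>b. b - b0) (box_vec n)) (box_vec n) =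
      (\<Sum>b\<in>?B. 1 - (if b - b0 \<in> ?B then c b else 0)) / of_nat N"
    using N by (simp add: sum_subtractf diff_divide_distrib N_def)
  then have "cmod (1 - vinner (ell2 UNIV) (weighted_perm c (\<lambda>b. b - b0) (box_vec n)) (box_vec n)) =
      cmod (\<Sum>b\<in>?B. 1 - (if b - b0 \<in> ?B then c b else 0)) / real N"
    by (simp add: norm_divide)
  also have "\<dots> \<le> (\<Sum>b\<in>?B. r + (if b - b0 \<notin> ?B then 1 else 0)) / real N"
  proof (intro divide_right_mono order.trans[OF norm_sum] sum_mono)
    fix b
    assume "b \<in> ?B"
    \<comment> \<open>At a lost point the left side is 1, and the bound needs
      \<open>0 \<le> r\<close>, which follows from the hypothesis at \<open>b\<close>
      itself.\<close>
    then show "cmod (1 - (if b - b0 \<in> ?B then c b else 0)) \<le> r + (if b - b0 \<notin> ?B then 1 else 0)"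
      using c[of b] order.trans[OF norm_ge_zero c[of b]] by auto
  qed simp
  also have "\<dots> = r + real (card {b \<in> ?B. b - b0 \<notin> ?B}) / real N"
    using N card_gt_0_iff[of ?B] by (simp add: sum.distrib add_divide_distrib N_def sum.If_cases finite_int_box Int_def
        conj_commute)
  also have "\<dots> \<le> r + (\<Sum>k\<in>UNIV. \<bar>real_of_int (b0 $ k)\<bar>) / (real n + 1)"
    unfolding N_def by (intro add_left_mono card_int_box_minus_translate)
  finally show ?thesis .
qed


subsection \<open>The representations \<open>U\<^sub>D\<close>\<close>

lemma U_D_eq: "U_D D x = weighted_perm (sigma_D D (fst x)) (\<lambda>b. b - snd x)"
  by (simp add: U_D_def V_D_def left_regular_def weighted_perm_def fun_eq_iff)

lemma abs_entry_le_max_entry: "\<bar>D $ k $ l\<bar> \<le> max_entry D"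
proof -
  have "{\<bar>D $ k $ l\<bar> | k l. True} = (\<lambda>(k, l). \<bar>D $ k $ l\<bar>) ` UNIV"
    by auto
  then have "finite {\<bar>D $ k $ l\<bar> | k l. True}"
    by simp
  then show ?thesis
    unfolding max_entry_def by (intro Max_ge) auto
qed

text \<open>With \<open>t\<close> the phase angle, the distance of \<open>exp (\<i> * t)\<close>
  from 1 is \<open>2 * \<bar>sin (t / 2)\<bar>\<close>, hence at most \<open>\<bar>t\<bar>\<close>.
  On the box every coordinate of \<open>b\<close> is at most \<open>n\<close>, so each row of
  \<open>D\<close> contributes at most \<open>CARD('q) * max_entry D * n\<close>.\<close>

lemma norm_one_minus_sigma_D_le:
  fixes D :: "real ^ 'q ^ 'p" and b :: "int ^ 'q"
  assumes "b \<in> int_box n"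
  shows "cmod (1 - sigma_D D a b) \<le>
    (\<Sum>k\<in>UNIV. \<bar>real_of_int (a $ k)\<bar>) * real CARD('q) * (real n * max_entry D)"
proof -
  let ?t = "real_vec a \<bullet> (D *v real_vec b)"
  have "cmod (1 - sigma_D D a b) = 2 * \<bar>sin (?t / 2)\<bar>"
    unfolding sigma_D_def by (subst norm_minus_commute) (rule dist_exp_i_1)
  also have "\<dots> \<le> \<bar>?t\<bar>"
    using abs_sin_x_le_abs_x[of "?t / 2"] by simp
  also have "\<dots> \<le> (\<Sum>k\<in>UNIV. \<bar>real_of_int (a $ k)\<bar> * \<bar>\<Sum>l\<in>UNIV. D $ k $ l * real_of_int (b $ l)\<bar>)"
    unfolding inner_vec_def real_vec_def matrix_vector_mult_def
    by (rule order.trans[OF sum_abs]) (simp add: abs_mult)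
  also have "\<dots> \<le> (\<Sum>k\<in>UNIV. \<bar>real_of_int (a $ k)\<bar> * (real CARD('q) * (max_entry D * real n)))"
  proof (intro sum_mono mult_left_mono)
    fix k
    have "\<bar>\<Sum>l\<in>UNIV. D $ k $ l * real_of_int (b $ l)\<bar> \<le> (\<Sum>l\<in>UNIV. \<bar>D $ k $ l\<bar> * \<bar>real_of_int (b $ l)\<bar>)"
      by (rule order.trans[OF sum_abs]) (simp add: abs_mult)
    also have "\<dots> \<le> (\<Sum>l\<in>(UNIV :: 'q set). max_entry D * real n)"
    proof (intro sum_mono mult_mono)
      fix l
      have "0 \<le> b $ l" "b $ l \<le> int n"
        using assms by (auto simp: int_box_def)
      then show "\<bar>real_of_int (b $ l)\<bar> \<le> real n"
        by linarith
      show "0 \<le> max_entry D"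
        using abs_entry_le_max_entry[of D k l] by linarith
    qed (auto simp: abs_entry_le_max_entry)
    finally show "\<bar>\<Sum>l\<in>UNIV. D $ k $ l * real_of_int (b $ l)\<bar> \<le> real CARD('q) * (max_entry D * real n)"
      by simp
  qed simp
  also have "\<dots> = (\<Sum>k\<in>UNIV. \<bar>real_of_int (a $ k)\<bar>) * real CARD('q) * (real n * max_entry D)"
    unfolding sum_distrib_right by (intro sum.cong) simp_all
  finally show ?thesis .
qed

theorem proposition4p3:
  fixes D :: "nat \<Rightarrow> real ^ 'q ^ 'p" and n :: "nat \<Rightarrow> nat"
  assumes "\<And>i k l. D i $ k $ l \<in> {- pi <.. pi}"
    and "\<And>i. 1 \<le> n i"
    and "summable (\<lambda>i. 1 / real (n i))"
    and "summable (\<lambda>i. real (n i) * max_entry (D i))"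
  shows "\<forall>x :: (int ^ 'p) \<times> (int ^ 'q).
           tensor_op_exists (\<lambda>i. box_vec (n i)) (\<lambda>i. U_D (D i) x)"
proof
  fix x :: "(int ^ 'p) \<times> (int ^ 'q)"
  define a where "a = fst x"
  define b where "b = snd x"
  interpret weighted_perm_seq "\<lambda>i. sigma_D (D i) a" "\<lambda>_ c. c - b" "\<lambda>i. box_vec (n i)"
  proof
    show "bij (\<lambda>c. c - b)"
      by (rule bij_betw_byWitness[where f' = "\<lambda>c. c + b"]) auto
  qed (simp_all add: sigma_D_def box_vec_mem vinner_box_vec)
  \<comment> \<open>\<open>A\<close> and \<open>B\<close> depend only on \<open>x\<close>, so they
    are constant coefficients of the two series assumed summable.\<close>
  define A where "A = (\<Sum>k\<in>UNIV. \<bar>real_of_int (a $ k)\<bar>) * real CARD('q)"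
  define B where "B = (\<Sum>k\<in>UNIV. \<bar>real_of_int (b $ k)\<bar>)"
  have "cmod (1 - overlap i) \<le> A * (real (n i) * max_entry (D i)) + B * (1 / real (n i))" for i
  proof -
    have "cmod (1 - overlap i) \<le> A * (real (n i) * max_entry (D i)) + B / (real (n i) + 1)"
      unfolding overlap_def A_def B_def
      by (rule norm_one_minus_overlap_le) (rule norm_one_minus_sigma_D_le)
    \<comment> \<open>A box has \<open>n i + 1\<close> points along each axis, whereas the
      hypothesis concerns \<open>1 / n i\<close>; \<open>1 \<le> n i\<close> makes the comparison
      legitimate.\<close>
    also have "B / (real (n i) + 1) \<le> B / real (n i)"
      using assms(2)[of i] by (intro divide_left_mono) (auto simp: B_def sum_nonneg)
    finally show ?thesis by simp
  qed
  then have "summable (\<lambda>i. cmod (1 - overlap i))"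
    by (intro summable_comparison_test'[OF summable_add[OF summable_mult[OF assms(4), of A]
          summable_mult[OF assms(3), of B]]]) simp
  then have "tensor_op_exists (\<lambda>i. box_vec (n i)) (\<lambda>i. weighted_perm (sigma_D (D i) a) (\<lambda>c. c - b))"
    by (rule tensor_op_exists_weighted_perm)
  then show "tensor_op_exists (\<lambda>i. box_vec (n i)) (\<lambda>i. U_D (D i) x)"
    by (simp add: U_D_eq a_def b_def)
qed

end
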